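(* Let $G$ be a planar graph with no $5$-cycles such that $\Delta(G) \le 4$. Then $\chi_\ell(G^2) \le 12$.
   Context: Graphs are finite and simple. $\Delta(G)$ denotes the maximum degree of $G$. "No $5$-cycles" means that $G$ has no cycle of length $5$ as a (not necessarily induced) subgraph. The square $G^2$ is the graph on vertex set $V(G)$ in which two distinct vertices are adjacent iff their distance in $G$ is at most $2$. A list assignment $L$ assigns to each vertex a list (set) of colors; an $L$-coloring is a proper coloring in which each vertex receives a color from its list. A graph is $k$-choosable if it has an $L$-coloring for every assignment $L$ of lists of size $k$ to its vertices. The choosability $\chi_\ell$ of a graph is the minimum $k$ such that the graph is $k$-choosable. *)

theory Defs
  imports
    "HOL-Analysis.Analysis"
    "Graph_Theory.Pair_Digraph"
    "Graph_Theory.Shortest_Path"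
begin

text \<open>
  A finite simple graph is a \<^locale>\<open>pair_graph\<close>: a finite loop-free symmetric digraph whose arcs
  are ordered pairs of vertices. Each undirected edge \<open>{u, v}\<close> is thus represented by the two arcs
  \<open>(u, v)\<close> and \<open>(v, u)\<close>.
\<close>

definition uedges :: "'a pair_pre_digraph \<Rightarrow> 'a set set" where
  "uedges G = {{u, v} | u v. (u, v) \<in> parcs G}"

text \<open>
  Planarity is topological: vertices are mapped to distinct points of the plane and edges to
  simple arcs between the images of their ends. An arc avoids all other vertices, and
  two arcs meet only in the images of common ends.
\<close>

definition plane_drawing ::
  "'a pair_pre_digraph \<Rightarrow> ('a \<Rightarrow> complex) \<Rightarrow> ('a set \<Rightarrow> real \<Rightarrow> complex) \<Rightarrow> bool" where
  "plane_drawing G p \<gamma> \<longleftrightarrow>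
     inj_on p (pverts G) \<and>
     (\<forall>e \<in> uedges G.
        arc (\<gamma> e) \<and>
        {pathstart (\<gamma> e), pathfinish (\<gamma> e)} = p ` e \<and>
        path_image (\<gamma> e) \<inter> p ` pverts G = p ` e) \<and>
     (\<forall>e \<in> uedges G. \<forall>e' \<in> uedges G. e \<noteq> e' \<longrightarrow>
        path_image (\<gamma> e) \<inter> path_image (\<gamma> e') \<subseteq> p ` (e \<inter> e'))"

definition planar :: "'a pair_pre_digraph \<Rightarrow> bool" where
  "planar G \<longleftrightarrow> (\<exists>p \<gamma>. plane_drawing G p \<gamma>)"

text \<open>
  By symmetry the out-degree is the number of neighbours. The inserted \<open>0\<close> only serves to
  give the null graph maximum degree \<open>0\<close>.
\<close>

definition max_degree :: "'a pair_pre_digraph \<Rightarrow> nat" where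
  "max_degree G = Max (insert 0 (out_degree (with_proj G) ` pverts G))"

text \<open>
  A \<^const>\<open>pre_digraph.cycle\<close> is a nonempty closed walk without repeated vertices, given by its
  list of arcs. In a symmetric digraph \<open>u, v, u\<close> counts as a cycle of length \<open>2\<close>, but for
  \<open>k \<ge> 3\<close> the cycles of length \<open>k\<close> are the usual ones.
\<close>

definition has_cycle_of_length :: "'a pair_pre_digraph \<Rightarrow> nat \<Rightarrow> bool" where
  "has_cycle_of_length G k \<longleftrightarrow> (\<exists>p. pre_digraph.cycle (with_proj G) p \<and> length p = k)"

text \<open>
  The minimum cost of a walk, \<^const>\<open>wf_digraph.\<mu>\<close>, is \<open>\<infinity>\<close> if there is none.
\<close>

definition graph_dist :: "'a pair_pre_digraph \<Rightarrow> 'a \<Rightarrow> 'a \<Rightarrow> ereal" where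
  "graph_dist G u v = wf_digraph.\<mu> (with_proj G) (\<lambda>_. 1) u v"

definition graph_square :: "'a pair_pre_digraph \<Rightarrow> 'a pair_pre_digraph" where
  "graph_square G =
     \<lparr>pverts = pverts G,
      parcs = {(u, v). u \<in> pverts G \<and> v \<in> pverts G \<and> u \<noteq> v \<and> graph_dist G u v \<le> 2}\<rparr>"

definition proper_coloring :: "'a pair_pre_digraph \<Rightarrow> ('a \<Rightarrow> 'c) \<Rightarrow> bool" where
  "proper_coloring G c \<longleftrightarrow> (\<forall>(u, v) \<in> parcs G. c u \<noteq> c v)"

definition list_coloring :: "'a pair_pre_digraph \<Rightarrow> ('a \<Rightarrow> 'c set) \<Rightarrow> ('a \<Rightarrow> 'c) \<Rightarrow> bool" where
  "list_coloring G L c \<longleftrightarrow> proper_coloring G c \<and> (\<forall>v \<in> pverts G. c v \<in> L v)"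

text \<open>
  Colors are natural numbers. On a finite graph this is no restriction, since
  only finitely many colors occur in the lists.
\<close>

definition choosable :: "'a pair_pre_digraph \<Rightarrow> nat \<Rightarrow> bool" where
  "choosable G k \<longleftrightarrow>
     (\<forall>L :: 'a \<Rightarrow> nat set.
        (\<forall>v \<in> pverts G. finite (L v) \<and> card (L v) = k) \<longrightarrow> (\<exists>c. list_coloring G L c))"

text \<open>
  The minimum exists: a finite simple graph with \<open>n\<close> vertices is \<open>n\<close>-choosable, by choosing
  distinct colors greedily.
\<close>

definition choosability :: "'a pair_pre_digraph \<Rightarrow> nat" where
  "choosability G = (LEAST k. choosable G k)"

end

theory Submission
  imports Defs
begin

text \<open>
  Fix lists of size 12 and take an edge-minimal graph \<open>E\<close> inside \<open>G\<close> whose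
  square has no coloring from them. Deleting edges only shrinks the square, so any nonempty set of
  edges of \<open>E\<close> can be deleted, the rest colored by minimality, the vertices near the
  deleted edges uncolored, and the coloring extended greedily. This succeeds unless these vertices
  have many neighbors in the square; for instance, no edge can have one end with at most 11 and the
  other with at most 12 such neighbors (\<open>light_edge\<close>). With degrees at most 4 a vertex
  starts from at most 16 neighbors in the square, and it loses 2 for every triangle and roughly 1
  for every 4-cycle through it (\<open>card_square_nbs\<close>). Hence \<open>E\<close> has few
  short cycles around each vertex.

  Planarity forces many short cycles. What is needed from the plane is the easy half of MacLane's
  criterion: the cycle space has a family \<open>B\<close> of at least \<open>|E| - |V| + 1\<close>
  independent members which together use every edge at most twice (\<open>planar_two_basis\<close>).
  The members of \<open>B\<close> are the boundaries, taken modulo 2, of all faces but one. This is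
  proved by adding the edges one at a time: Janiszewski's theorem shows that a new arc that closes a
  Jordan curve splits one face into exactly two, and that any other new arc splits none; the
  boundaries are even because every closed curve of the drawing is the sum of the boundaries of the
  faces inside it.

  Every member of \<open>B\<close> is a triangle, a 4-cycle, or has at least 6 edges, as there are
  no 5-cycles. Counting edges gives that the sum over all vertices of
  \<open>4 deg(v) - 12 - 2 t(v) - q(v)\<close> is negative, where \<open>t\<close> and
  \<open>q\<close> count the triangles and 4-cycles of \<open>B\<close> at \<open>v\<close>
  (\<open>total_charge_negative\<close>). On the other hand a vertex of degree 4 never has negative
  charge (\<open>charge_4_vertex\<close>), and next to vertices of degree 2 or 3 it has enough left
  to pay for them (\<open>charge_near_poor\<close>), so that after redistribution every charge is
  nonnegative (\<open>final_charge\<close>). This contradiction shows that there is no such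
  \<open>E\<close>.
\<close>

section \<open>Edge sets with even degrees and paths of edges\<close>

text \<open>
  These are the elements of the cycle space over the field with two elements.
\<close>

definition even_edges :: "'a set set \<Rightarrow> bool" where
  "even_edges Z \<longleftrightarrow> (\<forall>v. even (card {e \<in> Z. v \<in> e}))"

text \<open>
  \<open>edge_path E x y P W\<close> describes a simple path from \<open>x\<close> to
  \<open>y\<close> with edge set \<open>P\<close> and vertex set \<open>W\<close>. Carrying both
  sets along makes it possible to translate the path into an arc of the plane and to read off vertex
  degrees, without reasoning about lists.
\<close>

inductive edge_path :: "'a set set \<Rightarrow> 'a \<Rightarrow> 'a \<Rightarrow> 'a set set \<Rightarrow> 'a set \<Rightarrow> bool" for E where
  single: "{x, y} \<in> E \<Longrightarrow> x \<noteq> y \<Longrightarrow> edge_path E x y {{x, y}} {x, y}"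
| step: "{x, z} \<in> E \<Longrightarrow> edge_path E z y P W \<Longrightarrow> x \<notin> W \<Longrightarrow>
    edge_path E x y (insert {x, z} P) (insert x W)"

lemma edge_path_basics:
  assumes "edge_path E x y P W"
  shows "x \<in> W \<and> y \<in> W \<and> x \<noteq> y \<and> finite P \<and> P \<subseteq> E \<and> \<Union>P = W"
  using assms by induction auto

lemma edge_path_parity:
  assumes "edge_path E x y P W"
  shows "odd (card {e \<in> P. v \<in> e}) \<longleftrightarrow> v = x \<or> v = y"
  using assms
proof induction
  case (single x y)
  have "{e \<in> {{x, y}}. v \<in> e} = (if v = x \<or> v = y then {{x, y}} else {})" by auto
  then show ?case by simp
next
  case (step x z y P W)
  note b = edge_path_basics[OF step.hyps(2)]
  have new: "{x, z} \<notin> P" using b step.hyps(3) by auto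
  have "{e \<in> insert {x, z} P. v \<in> e} =
      (if v = x \<or> v = z then insert {x, z} {e \<in> P. v \<in> e} else {e \<in> P. v \<in> e})" by auto
  moreover have "finite {e \<in> P. v \<in> e}" using b by simp
  ultimately have "card {e \<in> insert {x, z} P. v \<in> e} =
      card {e \<in> P. v \<in> e} + (if v = x \<or> v = z then 1 else 0)"
    using new by auto
  then show ?case using step b by auto
qed

lemma edge_path_suffix:
  assumes "edge_path E z y P W" "x \<in> W" "x \<noteq> y"
  shows "\<exists>P' W'. edge_path E x y P' W'"
  using assms
proof (induction)
  case (single a b)
  then show ?case using edge_path.single[of a b E] by blast
next
  case (step a z b P W)
  then show ?case using edge_path.step[of a z E b P W] by blast
qed

definition edge_rel :: "'a set set \<Rightarrow> ('a \<times> 'a) set" where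
  "edge_rel E = {(a, b). {a, b} \<in> E \<and> a \<noteq> b}"

lemma reachable_edge_path:
  assumes "(x, y) \<in> (edge_rel E)\<^sup>*" "x \<noteq> y"
  shows "\<exists>P W. edge_path E x y P W"
  using assms
proof (induction rule: converse_rtrancl_induct)
  case base
  then show ?case by simp
next
  case (step x z)
  have xz: "{x, z} \<in> E" "x \<noteq> z" using step.hyps(1) by (auto simp: edge_rel_def)
  show ?case
  proof (cases "z = y")
    case True
    then show ?thesis using edge_path.single[OF xz] by blast
  next
    case False
    then obtain P W where P: "edge_path E z y P W" using step by blast
    show ?thesis
    proof (cases "x \<in> W")
      case True
      then show ?thesis using edge_path_suffix[OF P] step.prems by blast
    next
      case False
      then show ?thesis using edge_path.step[OF xz(1) P] by blast
    qed
  qed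
qed

lemma sym_edge_rel: "sym ((edge_rel E)\<^sup>*)"
  by (rule sym_rtrancl) (auto simp: edge_rel_def sym_def insert_commute)

lemma closure_finite_Union: "finite A \<Longrightarrow> closure (\<Union>A) = (\<Union>h\<in>A. closure h)"
  by (induction rule: finite_induct) auto

text \<open>
  Removing a part of one component affects only this component. Allowing \<open>X = Y\<close> covers
  both the case where the component splits and the case where it does not.
\<close>

lemma components_remove:
  fixes S :: "'a::real_normed_vector set"
  assumes "open S" "f \<in> components S" "f - I = X \<union> Y" "I \<subseteq> f"
    "open X" "connected X" "X \<noteq> {}" "open Y" "connected Y" "Y \<noteq> {}" "X = Y \<or> X \<inter> Y = {}"
  shows "components (S - I) = insert X (insert Y (components S - {f}))"
proof (rule components_open_unique)
  have disj: "A \<inter> B = {}" if "A \<in> components S" "B \<in> components S" "A \<noteq> B" for A B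
    using components_nonoverlap[OF that(1,2)] that(3) by simp
  show "pairwise disjnt (insert X (insert Y (components S - {f})))"
  proof -
    have "X \<inter> A = {}" "Y \<inter> A = {}" if "A \<in> components S - {f}" for A
      using disj[OF _ assms(2), of A] that assms(3) by auto
    then show ?thesis using assms(11) disj by (auto simp: pairwise_def disjnt_def)
  qed
  have "\<Union>(components S - {f}) = S - f"
  proof -
    have "A \<inter> f = {}" if "A \<in> components S - {f}" for A using disj[OF _ assms(2), of A] that by auto
    then have "f \<inter> \<Union>(components S - {f}) = {}" by blast
    moreover have "\<Union>(components S) = f \<union> \<Union>(components S - {f})" using assms(2) by blast
    moreover have "\<Union>(components S) = S" by (rule Union_components)
    ultimately show ?thesis by auto
  qed
  then have "\<Union>(insert X (insert Y (components S - {f}))) = (f - I) \<union> (S - f)"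
    by (simp add: assms(3) Un_assoc)
  also have "\<dots> = S - I" using in_components_subset[OF assms(2)] assms(4) by fast
  finally show "\<Union>(insert X (insert Y (components S - {f}))) = S - I" .
  show "open Z \<and> connected Z \<and> Z \<noteq> {}" if "Z \<in> insert X (insert Y (components S - {f}))" for Z
    using that assms(5-10) open_components[OF assms(1), of Z] in_components_connected[of Z S]
      in_components_nonempty[of Z S]
    by auto
qed

text \<open>
  If an even set is the sum modulo 2 of a family, and all members of the family but one are even,
  then so is the last one: sum the degrees of a fixed vertex over the family.
\<close>

lemma even_edges_transfer:
  assumes fin: "finite S" "finite E"
    and par: "\<And>g. g \<in> E \<Longrightarrow> g \<in> C \<longleftrightarrow> odd (card {h \<in> S. g \<in> Z h})"
    and sub: "\<And>h. h \<in> S \<Longrightarrow> Z h \<subseteq> E" "C \<subseteq> E"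
    and ev: "even_edges C" "h0 \<in> S" "\<And>h. h \<in> S \<Longrightarrow> h \<noteq> h0 \<Longrightarrow> even_edges (Z h)"
  shows "even_edges (Z h0)"
  unfolding even_edges_def
proof
  fix v
  let ?Ev = "{g \<in> E. v \<in> g}"
  have "(\<Sum>h\<in>S. card {g \<in> Z h. v \<in> g}) = (\<Sum>h\<in>S. \<Sum>g\<in>?Ev. if g \<in> Z h then 1 else 0)"
  proof (rule sum.cong[OF refl])
    fix h assume h: "h \<in> S"
    have "{g \<in> Z h. v \<in> g} = {g \<in> ?Ev. g \<in> Z h}" using sub h by auto
    moreover have "(\<Sum>g\<in>?Ev. if g \<in> Z h then 1 else 0) = card (?Ev \<inter> {g. g \<in> Z h})"
      using fin by (simp add: sum.If_cases)
    moreover have "?Ev \<inter> {g. g \<in> Z h} = {g \<in> ?Ev. g \<in> Z h}" by auto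
    ultimately show "card {g \<in> Z h. v \<in> g} = (\<Sum>g\<in>?Ev. if g \<in> Z h then 1 else 0)" by simp
  qed
  also have "\<dots> = (\<Sum>g\<in>?Ev. \<Sum>h\<in>S. if g \<in> Z h then 1 else 0)" by (rule sum.swap)
  also have "\<dots> = (\<Sum>g\<in>?Ev. card {h \<in> S. g \<in> Z h})"
    using fin by (auto intro!: sum.cong simp: sum.If_cases Int_def)
  finally have eq: "(\<Sum>h\<in>S. card {g \<in> Z h. v \<in> g}) = (\<Sum>g\<in>?Ev. card {h \<in> S. g \<in> Z h})" .
  have "even (\<Sum>g\<in>?Ev. card {h \<in> S. g \<in> Z h}) \<longleftrightarrow>
      even (card {g \<in> ?Ev. odd (card {h \<in> S. g \<in> Z h})})"
    using fin by (intro even_sum_iff) auto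
  moreover have "{g \<in> ?Ev. odd (card {h \<in> S. g \<in> Z h})} = {g \<in> C. v \<in> g}"
    using par sub(2) by auto
  ultimately have "even (\<Sum>h\<in>S. card {g \<in> Z h. v \<in> g})"
    using ev(1) eq by (simp add: even_edges_def)
  moreover have "(\<Sum>h\<in>S. card {g \<in> Z h. v \<in> g}) =
      card {g \<in> Z h0. v \<in> g} + (\<Sum>h\<in>S - {h0}. card {g \<in> Z h. v \<in> g})"
    using fin(1) ev(2) by (rule sum.remove)
  moreover have "even (\<Sum>h\<in>S - {h0}. card {g \<in> Z h. v \<in> g})"
    using ev(3) by (intro dvd_sum) (auto simp: even_edges_def)
  ultimately show "even (card {e \<in> Z h0. v \<in> e})" by simp
qed

section \<open>Faces of a plane drawing\<close>

text \<open>
  The edge set \<open>E0\<close> stays fixed, while the notions below refer to a subset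
  \<open>E\<close> of it. In this way the same curves serve all stages of the induction over the
  edges.
\<close>

locale drawing =
  fixes V :: "'a set" and p :: "'a \<Rightarrow> complex" and \<gamma> :: "'a set \<Rightarrow> real \<Rightarrow> complex"
    and E0 :: "'a set set"
  assumes finV: "finite V" and finE0: "finite E0"
    and edge: "e \<in> E0 \<Longrightarrow> \<exists>u v. u \<in> V \<and> v \<in> V \<and> u \<noteq> v \<and> e = {u, v}"
    and inj: "inj_on p V"
    and arc: "e \<in> E0 \<Longrightarrow> arc (\<gamma> e)"
    and ends: "e \<in> E0 \<Longrightarrow> {pathstart (\<gamma> e), pathfinish (\<gamma> e)} = p ` e"
    and vert: "e \<in> E0 \<Longrightarrow> path_image (\<gamma> e) \<inter> p ` V = p ` e"
    and meet: "e \<in> E0 \<Longrightarrow> e' \<in> E0 \<Longrightarrow> e \<noteq> e' \<Longrightarrow> path_image (\<gamma> e) \<inter> path_image (\<gamma> e') \<subseteq> p ` (e \<inter> e')"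
begin

definition img :: "'a set set \<Rightarrow> complex set" where
  "img E = (\<Union>e\<in>E. path_image (\<gamma> e))"

definition body :: "'a set set \<Rightarrow> complex set" where
  "body E = p ` V \<union> img E"

definition inner :: "'a set \<Rightarrow> complex set" where
  "inner e = path_image (\<gamma> e) - p ` e"

definition faces :: "'a set set \<Rightarrow> complex set set" where
  "faces E = components (- body E)"

text \<open>
  A face lies at an edge if it accumulates at some interior point of its arc. This notion does not
  mention the other edges, so a face that survives the addition of an edge keeps its edges.
\<close>

definition sides :: "'a set set \<Rightarrow> 'a set \<Rightarrow> complex set set" where
  "sides E g = {h \<in> faces E. closure h \<inter> inner g \<noteq> {}}"

text \<open>
  The boundary modulo 2: a bridge, which has the same face on both sides, does not belong to it.
\<close>

definition boundary :: "'a set set \<Rightarrow> complex set \<Rightarrow> 'a set set" where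
  "boundary E h = {g \<in> E. h \<in> sides E g \<and> (\<exists>h' \<in> sides E g. h' \<noteq> h)}"

lemma edge_subset: "e \<in> E0 \<Longrightarrow> e \<subseteq> V"
  using edge by blast

lemma compact_img: "E \<subseteq> E0 \<Longrightarrow> compact (img E)"
  unfolding img_def using finite_subset[OF _ finE0] arc by (auto intro!: compact_UN compact_arc_image)

lemma compact_body: "E \<subseteq> E0 \<Longrightarrow> compact (body E)"
  unfolding body_def using compact_img[of E] finV by (simp add: compact_Un finite_imp_compact)

lemma open_compl_body: "E \<subseteq> E0 \<Longrightarrow> open (- body E)"
  using compact_body compact_imp_closed by (auto simp: open_Compl)

lemma connected_inner: "e \<in> E0 \<Longrightarrow> connected (inner e)"
  unfolding inner_def using connected_simple_path_endless[OF arc_imp_simple_path[OF arc]] ends by simp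

lemma inner_nonempty: "e \<in> E0 \<Longrightarrow> inner e \<noteq> {}"
  unfolding inner_def using nonempty_simple_path_endless[OF arc_imp_simple_path[OF arc]] ends by simp

lemma endpoints_in_arc: "e \<in> E0 \<Longrightarrow> p ` e \<subseteq> path_image (\<gamma> e)"
  using vert by blast

lemma closure_inner: "e \<in> E0 \<Longrightarrow> closure (inner e) \<subseteq> path_image (\<gamma> e)"
  unfolding inner_def by (rule closure_minimal) (auto simp: arc closed_arc_image)

lemma inner_disjoint_arc:
  assumes "e \<in> E0" "e' \<in> E0" "e \<noteq> e'"
  shows "inner e \<inter> path_image (\<gamma> e') = {}"
  using meet[OF assms] unfolding inner_def by blast

lemma inner_disjoint_img: "e \<in> E0 \<Longrightarrow> E \<subseteq> E0 \<Longrightarrow> e \<notin> E \<Longrightarrow> inner e \<inter> img E = {}"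
  unfolding img_def using inner_disjoint_arc by blast

lemma inner_disjoint_body: "e \<in> E0 \<Longrightarrow> E \<subseteq> E0 \<Longrightarrow> e \<notin> E \<Longrightarrow> inner e \<inter> body E = {}"
  unfolding body_def using inner_disjoint_img[of e E] vert[of e] by (auto simp: inner_def)

lemma arc_Int_body:
  assumes "e \<in> E0" "E \<subseteq> E0" "e \<notin> E"
  shows "path_image (\<gamma> e) \<inter> body E = p ` e"
  using inner_disjoint_body[OF assms] endpoints_in_arc[OF assms(1)] edge_subset[OF assms(1)]
  unfolding inner_def body_def by blast

lemma body_insert: "e \<in> E0 \<Longrightarrow> body (insert e E) = body E \<union> inner e"
  unfolding body_def inner_def img_def using edge_subset[of e] endpoints_in_arc[of e] by auto

lemma faces_insert_eq: "e \<in> E0 \<Longrightarrow> faces (insert e E) = components (- body E - inner e)"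
  unfolding faces_def by (simp add: body_insert Diff_eq)

lemma oriented_arc:
  assumes "{x, y} \<in> E0"
  shows "\<exists>g. arc g \<and> pathstart g = p x \<and> pathfinish g = p y \<and> path_image g = path_image (\<gamma> {x, y})"
proof -
  have "{pathstart (\<gamma> {x, y}), pathfinish (\<gamma> {x, y})} = {p x, p y}"
    using ends[OF assms] by simp
  then consider "pathstart (\<gamma> {x, y}) = p x" "pathfinish (\<gamma> {x, y}) = p y"
    | "pathstart (\<gamma> {x, y}) = p y" "pathfinish (\<gamma> {x, y}) = p x"
    by (auto simp: doubleton_eq_iff)
  then show ?thesis
  proof cases
    case 1
    then show ?thesis using arc[OF assms] by blast
  next
    case 2
    then show ?thesis using arc_reversepath[OF arc[OF assms]]
      by (intro exI[of _ "reversepath (\<gamma> {x, y})"]) simp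
  qed
qed

lemma edge_path_arc:
  assumes "edge_path E x y P W" "E \<subseteq> E0"
  shows "\<exists>g. arc g \<and> pathstart g = p x \<and> pathfinish g = p y \<and> path_image g = img P"
  using assms
proof induction
  case (single x y)
  then show ?case using oriented_arc[of x y] by (auto simp: img_def)
next
  case (step x z y P W)
  note b = edge_path_basics[OF step.hyps(2)]
  obtain g where g: "arc g" "pathstart g = p z" "pathfinish g = p y" "path_image g = img P"
    using step by blast
  obtain k where k: "arc k" "pathstart k = p x" "pathfinish k = p z"
    "path_image k = path_image (\<gamma> {x, z})"
    using oriented_arc[of x z] step by blast
  have "path_image k \<inter> path_image g \<subseteq> {pathstart g}"
  proof
    fix a assume a: "a \<in> path_image k \<inter> path_image g"
    then obtain e where e: "e \<in> P" "a \<in> path_image (\<gamma> e)" using g by (auto simp: img_def)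
    have "x \<notin> e" using e b step.hyps(3) by auto
    then have "{x, z} \<noteq> e" "{x, z} \<inter> e \<subseteq> {z}" by auto
    moreover have "a \<in> p ` ({x, z} \<inter> e)"
      using meet[of "{x, z}" e] a k(4) e b step.hyps(1) step.prems \<open>{x, z} \<noteq> e\<close> by blast
    ultimately show "a \<in> {pathstart g}" using g by auto
  qed
  then have "arc (k +++ g)" using arc_join[OF k(1) g(1)] k g by simp
  moreover have "path_image (k +++ g) = img (insert {x, z} P)"
    using path_image_join[of k g] k g by (simp add: img_def)
  ultimately show ?case using k g by (intro exI[of _ "k +++ g"]) simp
qed

text \<open>
  The edge set of a cycle of the drawing, seen both as an even edge set and as a closed curve.
\<close>

definition jordan_curve :: "'a set set \<Rightarrow> bool" where
  "jordan_curve C \<longleftrightarrow> C \<subseteq> E0 \<and> even_edges C \<and>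
     (\<exists>c. simple_path c \<and> pathfinish c = pathstart c \<and> path_image c = img C)"

lemma close_path:
  assumes E: "E \<subseteq> E0" and e: "{u, v} \<in> E0" "{u, v} \<notin> E" and P: "edge_path E u v P W"
  shows "jordan_curve (insert {u, v} P)" "connected (body E \<inter> img (insert {u, v} P))"
proof -
  note b = edge_path_basics[OF P]
  obtain g where g: "arc g" "pathstart g = p u" "pathfinish g = p v" "path_image g = img P"
    using edge_path_arc[OF P E] by blast
  have "{v, u} \<in> E0" using e by (simp add: insert_commute)
  then obtain k where k: "arc k" "pathstart k = p v" "pathfinish k = p u"
    "path_image k = path_image (\<gamma> {u, v})"
    using oriented_arc[of v u] by (auto simp: insert_commute)
  have sub: "img P \<subseteq> body E" using b by (auto simp: body_def img_def)
  have PI: "path_image (\<gamma> {u, v}) \<inter> body E = {p u, p v}"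
    using arc_Int_body[OF e(1) E e(2)] by simp
  have "path_image g \<inter> path_image k \<subseteq> {pathstart g, pathstart k}"
    using g k sub PI by auto
  then have 1: "simple_path (g +++ k)" using simple_path_join_loop[OF g(1) k(1)] g k by simp
  have 2: "path_image (g +++ k) = img (insert {u, v} P)"
    using path_image_join[of g k] k g by (auto simp: img_def)
  have ev: "even_edges (insert {u, v} P)"
    unfolding even_edges_def
  proof
    fix w
    have new: "{u, v} \<notin> P" using b e by auto
    have "{e \<in> insert {u, v} P. w \<in> e} =
        (if w = u \<or> w = v then insert {u, v} {e \<in> P. w \<in> e} else {e \<in> P. w \<in> e})" by auto
    moreover have "finite {e \<in> P. w \<in> e}" using b by simp
    ultimately have "card {e \<in> insert {u, v} P. w \<in> e} =
        card {e \<in> P. w \<in> e} + (if w = u \<or> w = v then 1 else 0)"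
      using new by auto
    then show "even (card {e \<in> insert {u, v} P. w \<in> e})" using edge_path_parity[OF P, of w] by auto
  qed
  show "jordan_curve (insert {u, v} P)"
    unfolding jordan_curve_def using 1 2 g k b E e ev by (auto intro!: exI[of _ "g +++ k"])
  have "{p u, p v} \<subseteq> img P"
    using g pathstart_in_path_image[of g] pathfinish_in_path_image[of g] by auto
  then have "body E \<inter> img (insert {u, v} P) = img P"
    using sub PI unfolding img_def by blast
  then show "connected (body E \<inter> img (insert {u, v} P))"
    using connected_arc_image[OF g(1)] g(4) by simp
qed

lemma jordan_curveD:
  assumes "jordan_curve C"
  shows "open (inside (img C))" "open (outside (img C))"
    "inside (img C) \<union> outside (img C) = - img C" "inside (img C) \<inter> outside (img C) = {}"
    "connected (inside (img C))" "connected (outside (img C))"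
    "frontier (inside (img C)) = img C" "frontier (outside (img C)) = img C" "closed (img C)"
proof -
  obtain c where c: "simple_path c" "pathfinish c = pathstart c" "path_image c = img C"
    using assms by (auto simp: jordan_curve_def)
  show "open (inside (img C))" "open (outside (img C))"
    "inside (img C) \<union> outside (img C) = - img C" "inside (img C) \<inter> outside (img C) = {}"
    "connected (inside (img C))" "connected (outside (img C))"
    "frontier (inside (img C)) = img C" "frontier (outside (img C)) = img C" "closed (img C)"
    using Jordan_inside_outside[OF c(1,2)] closed_simple_path_image[OF c(1)] c(3) by auto
qed

text \<open>
  The inside and the outside of a closed curve play symmetric roles, hence they are treated alike.
\<close>

definition regions :: "'a set set \<Rightarrow> complex set set" where
  "regions C = {inside (img C), outside (img C)}"

lemma regionD:
  assumes "jordan_curve C" "D \<in> regions C"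
  shows "open D" "connected D" "D \<inter> img C = {}" "frontier D = img C"
proof -
  note j = jordan_curveD[OF assms(1)]
  have D: "D = inside (img C) \<or> D = outside (img C)" using assms(2) by (simp add: regions_def)
  show "open D" using D j(1,2) by (elim disjE) simp_all
  show "connected D" using D j(5,6) by (elim disjE) simp_all
  show "D \<inter> img C = {}" using D j(3) by blast
  show "frontier D = img C" using D j(7,8) by (elim disjE) simp_all
qed

lemma connected_in_region:
  assumes "jordan_curve C" "connected h" "h \<inter> img C = {}"
  shows "\<exists>D \<in> regions C. h \<subseteq> D"
proof -
  note j = jordan_curveD[OF assms(1)]
  have "h \<subseteq> inside (img C) \<union> outside (img C)" using j(3) assms(3) by blast
  then have "inside (img C) \<inter> h = {} \<or> outside (img C) \<inter> h = {}"
    using connectedD[OF assms(2) j(1,2)] j(4) by blast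
  then show ?thesis
    using \<open>h \<subseteq> inside (img C) \<union> outside (img C)\<close> unfolding regions_def by blast
qed

lemma regions_disjoint:
  "jordan_curve C \<Longrightarrow> D \<in> regions C \<Longrightarrow> D' \<in> regions C \<Longrightarrow> D \<noteq> D' \<Longrightarrow> D \<inter> D' = {}"
  using jordan_curveD(4)[of C] unfolding regions_def by blast

lemma faceD:
  assumes "E \<subseteq> E0" "h \<in> faces E"
  shows "open h" "connected h" "h \<noteq> {}" "h \<inter> body E = {}"
proof -
  have h: "h \<in> components (- body E)" using assms(2) by (simp add: faces_def)
  show "open h" by (rule open_components[OF open_compl_body[OF assms(1)] h])
  show "connected h" by (rule in_components_connected[OF h])
  show "h \<noteq> {}" by (rule in_components_nonempty[OF h])
  show "h \<inter> body E = {}" using in_components_subset[OF h] by blast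
qed

lemma face_disjoint: "h \<in> faces E \<Longrightarrow> h' \<in> faces E \<Longrightarrow> h \<noteq> h' \<Longrightarrow> h \<inter> h' = {}"
  unfolding faces_def using components_nonoverlap by blast

lemma Union_faces: "\<Union>(faces E) = - body E"
  unfolding faces_def by (rule Union_components)

lemma face_containing_inner:
  assumes "E \<subseteq> E0" "e \<in> E0" "e \<notin> E"
  obtains f where "f \<in> faces E" "inner e \<subseteq> f"
proof -
  have "inner e \<subseteq> - body E" using inner_disjoint_body[OF assms(2,1,3)] by blast
  moreover have "- body E \<noteq> {}" using inner_nonempty[OF assms(2)] calculation by blast
  ultimately show ?thesis
    using exists_component_superset[OF _ _ connected_inner[OF assms(2)]] that
    unfolding faces_def by blast
qed

lemma face_in_region:
  assumes "E \<subseteq> E0" "jordan_curve C" "C \<subseteq> E" "h \<in> faces E"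
  shows "\<exists>D \<in> regions C. h \<subseteq> D"
proof -
  have "h \<inter> img C = {}" using faceD(4)[OF assms(1,4)] assms(3) by (auto simp: body_def img_def)
  then show ?thesis using connected_in_region[OF assms(2) faceD(2)[OF assms(1,4)]] by blast
qed

text \<open>
  Every point of a Jordan curve is a limit of points of either region. Near an interior point of
  \<open>g\<close> the drawing consists of \<open>g\<close> alone, so these points lie in faces, and
  one of the finitely many faces accumulates there.
\<close>

lemma sides_at_region:
  assumes "E \<subseteq> E0" "finite (faces E)" "jordan_curve C" "C \<subseteq> E" "g \<in> C" "D \<in> regions C"
  shows "\<exists>h \<in> sides E g. h \<subseteq> D"
proof -
  have gE: "g \<in> E0" using assms by auto
  obtain z where z: "z \<in> inner g" using inner_nonempty[OF gE] by blast
  note D = regionD[OF assms(3,6)]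
  have "z \<in> img C" using z assms(5) by (auto simp: img_def inner_def)
  then have zD: "z \<in> closure D" using D(4) by (auto simp: frontier_def)
  \<comment> \<open>a neighborhood of the point in which the drawing consists of \<open>g\<close> only\<close>
  let ?N = "- body (E - {g})"
  have N: "open ?N" "z \<in> ?N"
    using open_compl_body[of "E - {g}"] assms(1) inner_disjoint_body[OF gE, of "E - {g}"] z by auto
  have "E = insert g (E - {g})" using assms by auto
  then have bE: "body E = body (E - {g}) \<union> inner g" using body_insert[OF gE] by metis
  have "inner g \<subseteq> img C" using assms(5) by (auto simp: img_def inner_def)
  then have sub: "D \<inter> ?N \<subseteq> D - body E" using bE D(3) by blast
  have "z \<in> closure (D \<inter> ?N)"
    using open_Int_closure_subset[OF N(1), of D] zD N(2) by (auto simp: Int_commute)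
  then have "z \<in> closure (D - body E)" using closure_mono[OF sub] by blast
  moreover have "D - body E \<subseteq> \<Union>{h \<in> faces E. h \<subseteq> D}"
  proof
    fix x assume x: "x \<in> D - body E"
    then obtain h where h: "h \<in> faces E" "x \<in> h" using Union_faces[of E] by blast
    then obtain D' where "D' \<in> regions C" "h \<subseteq> D'" using face_in_region[OF assms(1,3,4)] by blast
    then have "h \<subseteq> D" using regions_disjoint[OF assms(3) assms(6)] x h(2) by blast
    then show "x \<in> \<Union>{h \<in> faces E. h \<subseteq> D}" using h by blast
  qed
  ultimately have "z \<in> closure (\<Union>{h \<in> faces E. h \<subseteq> D})" using closure_mono by blast
  moreover have "closure (\<Union>{h \<in> faces E. h \<subseteq> D}) = (\<Union>h \<in> {h \<in> faces E. h \<subseteq> D}. closure h)"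
    using closure_finite_Union[of "{h \<in> faces E. h \<subseteq> D}"] assms(2) by simp
  ultimately show ?thesis using z unfolding sides_def by blast
qed

text \<open>
  An arc off the curve lies in one region, hence so do all faces that touch it.
\<close>

lemma sides_in_region:
  assumes "E \<subseteq> E0" "jordan_curve C" "C \<subseteq> E" "g \<in> E - C"
  shows "\<exists>D \<in> regions C. \<forall>h \<in> sides E g. h \<subseteq> D"
proof -
  have gE: "g \<in> E0" using assms by auto
  have "inner g \<inter> img C = {}" using inner_disjoint_img[OF gE, of C] assms by auto
  then obtain D where D: "D \<in> regions C" "inner g \<subseteq> D"
    using connected_in_region[OF assms(2) connected_inner[OF gE]] by blast
  have "h \<subseteq> D" if h: "h \<in> sides E g" for h
  proof -
    have hf: "h \<in> faces E" and "closure h \<inter> D \<noteq> {}" using h D(2) by (auto simp: sides_def)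
    then have "h \<inter> D \<noteq> {}" using open_Int_closure_eq_empty[OF regionD(1)[OF assms(2) D(1)], of h] by auto
    moreover obtain D' where "D' \<in> regions C" "h \<subseteq> D'" using face_in_region[OF assms(1-3) hf] by blast
    ultimately show ?thesis using regions_disjoint[OF assms(2) D(1)] by blast
  qed
  then show ?thesis using D(1) by blast
qed

section \<open>Adding an edge to a drawing\<close>

lemma finite_edges: "E \<subseteq> E0 \<Longrightarrow> finite E"
  using finite_subset finE0 by blast

lemma region_other:
  assumes "jordan_curve C" "D \<in> regions C"
  obtains D' where "D' \<in> regions C" "D \<inter> D' = {}" "D \<union> D' = - img C" "regions C = {D, D'}"
proof -
  note j = jordan_curveD[OF assms(1)]
  have D: "D = inside (img C) \<or> D = outside (img C)" using assms(2) by (simp add: regions_def)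
  then show ?thesis
  proof
    assume "D = inside (img C)"
    then show ?thesis using that[of "outside (img C)"] j(3,4) by (simp add: regions_def)
  next
    assume "D = outside (img C)"
    then show ?thesis
      using that[of "inside (img C)"] j(3,4)
      by (simp add: regions_def Un_commute Int_commute insert_commute)
  qed
qed

text \<open>
  Two points of a face which lie in the same region of the curve are separated neither by the old
  drawing nor by the curve. As the two closed sets meet in a connected set, Janiszewski's theorem
  says that their union does not separate the points either.
\<close>

lemma face_region_connected:
  assumes E: "E \<subseteq> E0" and f: "f \<in> faces E" and C: "jordan_curve C" "connected (body E \<inter> img C)"
    and D: "D \<in> regions C"
  shows "connected (f \<inter> D)"
proof -
  have "connected_component (f \<inter> D) x y" if x: "x \<in> f \<inter> D" and y: "y \<in> f \<inter> D" for x y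
  proof -
    note fD = faceD[OF E f] and DD = regionD[OF C(1) D]
    have "connected_component (- body E) x y"
      unfolding connected_component_def using fD x y by (intro exI[of _ f]) auto
    moreover have "connected_component (- img C) x y"
      unfolding connected_component_def using DD x y by (intro exI[of _ D]) auto
    ultimately have "connected_component (- (body E \<union> img C)) x y"
      using Janiszewski[OF compact_body[OF E] jordan_curveD(9)[OF C(1)] C(2)] by blast
    then obtain T where T: "connected T" "T \<subseteq> - (body E \<union> img C)" "x \<in> T" "y \<in> T"
      by (auto simp: connected_component_def)
    have "T \<subseteq> f"
      using components_maximal[OF f[unfolded faces_def] T(1)] T x by blast
    moreover obtain D' where "D' \<in> regions C" "T \<subseteq> D'"
      using connected_in_region[OF C(1) T(1)] T(2) by blast
    then have "T \<subseteq> D" using regions_disjoint[OF C(1) D] T(3) x by blast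
    ultimately show ?thesis
      unfolding connected_component_def using T by (intro exI[of _ T]) auto
  qed
  then show ?thesis by (simp add: connected_iff_connected_component)
qed

lemma face_split_by_cycle:
  assumes E: "E \<subseteq> E0" and e: "e \<in> E0" "e \<notin> E" and f: "f \<in> faces E" "inner e \<subseteq> f"
    and C: "jordan_curve (insert e P)" "P \<subseteq> E" "connected (body E \<inter> img (insert e P))"
    and D: "regions (insert e P) = {D, D'}" "D \<inter> D' = {}" "D \<union> D' = - img (insert e P)"
  shows "faces (insert e E) = insert (f \<inter> D) (insert (f \<inter> D') (faces E - {f}))"
    "f \<inter> D \<noteq> {}" "f \<inter> D' \<noteq> {}" "f - inner e = (f \<inter> D) \<union> (f \<inter> D')"
proof -
  have DD: "D \<in> regions (insert e P)" "D' \<in> regions (insert e P)" using D by auto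
  note fD = faceD[OF E f(1)]
  obtain z where z: "z \<in> inner e" using inner_nonempty[OF e(1)] by blast
  have ne: "f \<inter> B \<noteq> {}" if B: "B \<in> regions (insert e P)" for B
  proof -
    have "z \<in> img (insert e P)" using z by (auto simp: img_def inner_def)
    then have "z \<in> closure B" using regionD(4)[OF C(1) B] by (auto simp: frontier_def)
    then show ?thesis using open_Int_closure_eq_empty[OF fD(1), of B] z f(2) by auto
  qed
  show 1: "f \<inter> D \<noteq> {}" and 2: "f \<inter> D' \<noteq> {}" using ne DD by auto
  have "f \<inter> img P = {}" using fD(4) C(2) by (auto simp: body_def img_def)
  moreover have "img (insert e P) = img P \<union> path_image (\<gamma> e)" by (auto simp: img_def)
  moreover have "f \<inter> path_image (\<gamma> e) = inner e"
    using f(2) fD(4) arc_Int_body[OF e(1) E e(2)] by (auto simp: inner_def)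
  ultimately have "f \<inter> img (insert e P) = inner e" by blast
  then show 3: "f - inner e = (f \<inter> D) \<union> (f \<inter> D')" using D(3) by blast
  show "faces (insert e E) = insert (f \<inter> D) (insert (f \<inter> D') (faces E - {f}))"
    unfolding faces_insert_eq[OF e(1)] unfolding faces_def
  proof (rule components_remove[OF open_compl_body[OF E] f(1)[unfolded faces_def] 3 f(2)])
    show "open (f \<inter> D)" "open (f \<inter> D')" using fD(1) regionD(1)[OF C(1)] DD by (auto intro: open_Int)
    show "connected (f \<inter> D)" "connected (f \<inter> D')"
      using face_region_connected[OF E f(1) C(1,3)] DD by auto
  qed (use 1 2 D(2) in auto)
qed

text \<open>
  If the ends of the new edge lie in different components of the graph, then the drawing is the
  disjoint union of two compact sets, each of which meets the new arc in a single point. Applying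
  Janiszewski's theorem twice, to attach first the arc and then the second compact set, shows that
  no points of the face get separated.
\<close>

lemma face_not_split:
  assumes E: "E \<subseteq> E0" and e: "{u, v} \<in> E0" "{u, v} \<notin> E" and f: "f \<in> faces E" "inner {u, v} \<subseteq> f"
    and unr: "(u, v) \<notin> (edge_rel E)\<^sup>*"
  shows "faces (insert {u, v} E) = insert (f - inner {u, v}) (faces E - {f})"
    "f - inner {u, v} \<noteq> {}"
proof -
  define e where "e = {u, v}"
  have e0: "e \<in> E0" "e \<notin> E" using e by (auto simp: e_def)
  \<comment> \<open>the component of \<open>u\<close>, and the part of the drawing on a given set of vertices\<close>
  define R where "R = {x \<in> V. (u, x) \<in> (edge_rel E)\<^sup>*}"
  define K where "K A = p ` A \<union> img {g \<in> E. g \<subseteq> A}" for A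
  have uv: "u \<in> V" "v \<in> V" "u \<noteq> v" using edge[OF e(1)] by (auto simp: doubleton_eq_iff)
  have uR: "u \<in> R" "v \<notin> R" using uv unr by (auto simp: R_def)
  have split: "g \<subseteq> R \<or> g \<subseteq> V - R" if gE: "g \<in> E" for g
  proof -
    obtain a b where ab: "a \<in> V" "b \<in> V" "a \<noteq> b" "g = {a, b}" using edge[OF subsetD[OF E gE]] by blast
    then have "(a, b) \<in> edge_rel E" "(b, a) \<in> edge_rel E"
      using gE by (auto simp: edge_rel_def insert_commute)
    then have "a \<in> R \<longleftrightarrow> b \<in> R" using ab unfolding R_def by (auto intro: rtrancl_into_rtrancl)
    then show ?thesis using ab by auto
  qed
  have KU: "K R \<union> K (V - R) = body E"
  proof -
    have "p ` R \<union> p ` (V - R) = p ` V" unfolding R_def by blast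
    moreover have "img {g \<in> E. g \<subseteq> R} \<union> img {g \<in> E. g \<subseteq> V - R} = img E"
      using split unfolding img_def by blast
    ultimately show ?thesis unfolding K_def body_def by blast
  qed
  have KI: "K R \<inter> K (V - R) = {}"
  proof -
    have RV: "R \<subseteq> V" by (auto simp: R_def)
    have sep: "p ` A \<inter> p ` B = {}" if "A \<subseteq> V" "B \<subseteq> V" "A \<inter> B = {}" for A B
      using inj that by (auto dest: inj_onD)
    have a: "path_image (\<gamma> g) \<inter> p ` A = {}" if "g \<in> E" "A \<subseteq> V" "g \<inter> A = {}" for g A
    proof -
      have "path_image (\<gamma> g) \<inter> p ` A \<subseteq> p ` g \<inter> p ` A" using vert[OF subsetD[OF E that(1)]] that(2) by blast
      moreover have "p ` g \<inter> p ` A = {}"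
        by (rule sep) (use that edge_subset[OF subsetD[OF E that(1)]] in auto)
      ultimately show ?thesis by blast
    qed
    have b: "path_image (\<gamma> g) \<inter> path_image (\<gamma> g') = {}" if "g \<in> E" "g' \<in> E" "g \<inter> g' = {}" "g \<noteq> {}" for g g'
      using meet[of g g'] that E by auto
    have ne: "g \<noteq> {}" if "g \<in> E" for g using edge[OF subsetD[OF E that]] by blast
    have "p ` R \<inter> p ` (V - R) = {}" by (rule sep) (use RV in auto)
    moreover have "p ` R \<inter> img {g \<in> E. g \<subseteq> V - R} = {}"
      unfolding img_def using a[of _ R] RV by blast
    moreover have "img {g \<in> E. g \<subseteq> R} \<inter> p ` (V - R) = {}"
      unfolding img_def using a[of _ "V - R"] by blast
    moreover have "img {g \<in> E. g \<subseteq> R} \<inter> img {g \<in> E. g \<subseteq> V - R} = {}"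
    proof -
      have "path_image (\<gamma> g) \<inter> path_image (\<gamma> g') = {}"
        if "g \<in> E" "g \<subseteq> R" "g' \<in> E" "g' \<subseteq> V - R" for g g'
        by (rule b) (use that ne in auto)
      then show ?thesis unfolding img_def by blast
    qed
    ultimately show ?thesis unfolding K_def by blast
  qed
  have KC: "compact (K A)" if "A \<subseteq> V" for A
  proof -
    have "compact (p ` A)" using finite_subset[OF that finV] by (simp add: finite_imp_compact)
    moreover have "compact (img {g \<in> E. g \<subseteq> A})" by (rule compact_img) (use E in auto)
    ultimately show ?thesis unfolding K_def by (rule compact_Un)
  qed
  have RV: "R \<subseteq> V" by (auto simp: R_def)
  have pe: "path_image (\<gamma> e) \<inter> body E = {p u, p v}" using arc_Int_body[OF e0(1) E e0(2)] by (simp add: e_def)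
  have pu: "p u \<in> K R" "p v \<in> K (V - R)" using uR uv by (auto simp: K_def)
  have nu: "p v \<notin> K R" "p u \<notin> K (V - R)" using pu KI by auto
  have "K R \<inter> path_image (\<gamma> e) = K R \<inter> (path_image (\<gamma> e) \<inter> body E)"
    unfolding KU[symmetric] by auto
  then have I1: "K R \<inter> path_image (\<gamma> e) = {p u}" unfolding pe using pu nu by auto
  have "(K R \<union> path_image (\<gamma> e)) \<inter> K (V - R) = K (V - R) \<inter> (path_image (\<gamma> e) \<inter> body E)"
    unfolding KU[symmetric] using KI by auto
  then have I2: "(K R \<union> path_image (\<gamma> e)) \<inter> K (V - R) = {p v}" unfolding pe using pu nu by auto
  note fD = faceD[OF E f(1)]
  have conn: "connected_component (f - inner e) x y" if x: "x \<in> f - inner e" and y: "y \<in> f - inner e" for x y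
  proof -
    have full: "connected_component (- body E) x y"
      unfolding connected_component_def using fD x y by (intro exI[of _ f]) auto
    have c1: "connected_component (- K R) x y" and c2: "connected_component (- K (V - R)) x y"
      using connected_component_of_subset[OF full] KU by auto
    have xy: "x \<notin> path_image (\<gamma> e)" "y \<notin> path_image (\<gamma> e)"
      using x y fD(4) pe by (auto simp: inner_def e_def)
    have "connected (- path_image (\<gamma> e))"
      by (rule connected_arc_complement) (use arc[OF e0(1)] in auto)
    then have c3: "connected_component (- path_image (\<gamma> e)) x y"
      using xy by (auto simp: connected_iff_connected_component)
    \<comment> \<open>first attach the arc to the component of \<open>u\<close>, then the rest of the drawing\<close>
    have "connected (K R \<inter> path_image (\<gamma> e))" by (simp add: I1)
    from Janiszewski[OF KC[OF RV] closed_arc_image[OF arc[OF e0(1)]] this c1 c3]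
    have c4: "connected_component (- (K R \<union> path_image (\<gamma> e))) x y" .
    have "compact (K R \<union> path_image (\<gamma> e))"
      by (rule compact_Un[OF KC[OF RV] compact_arc_image[OF arc[OF e0(1)]]])
    moreover have "closed (K (V - R))" using KC[of "V - R"] by (simp add: compact_imp_closed)
    moreover have "connected ((K R \<union> path_image (\<gamma> e)) \<inter> K (V - R))" by (simp add: I2)
    ultimately have "connected_component (- ((K R \<union> path_image (\<gamma> e)) \<union> K (V - R))) x y"
      using c4 c2 by (rule Janiszewski)
    then obtain T where T: "connected T" "T \<subseteq> - ((K R \<union> path_image (\<gamma> e)) \<union> K (V - R))" "x \<in> T" "y \<in> T"
      by (auto simp: connected_component_def)
    have T2: "T \<subseteq> - body E" "T \<inter> inner e = {}" using T(2) KU by (auto simp: inner_def)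
    have "T \<subseteq> f" using components_maximal[OF f(1)[unfolded faces_def] T(1)] T2(1) T(3) x by blast
    then show ?thesis unfolding connected_component_def using T T2 by (intro exI[of _ T]) auto
  qed
  have con: "connected (f - inner e)" using conn by (simp add: connected_iff_connected_component)
  have op: "open (f - inner e)"
  proof -
    have "f - inner e = f - path_image (\<gamma> e)" using fD(4) pe by (auto simp: inner_def e_def)
    then show ?thesis using fD(1) closed_arc_image[OF arc[OF e0(1)]] by (simp add: open_Diff)
  qed
  show ne: "f - inner {u, v} \<noteq> {}"
  proof
    \<comment> \<open>the face would be an open part of an arc, and the plane minus the two ends would fall apart\<close>
    assume "f - inner {u, v} = {}"
    then have "f \<subseteq> path_image (\<gamma> e)" by (auto simp: inner_def e_def)
    moreover have "inner e \<subseteq> f" using f(2) by (simp add: e_def)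
    ultimately have cover: "- {p u, p v} \<subseteq> f \<union> - path_image (\<gamma> e)"
      by (auto simp: inner_def e_def)
    have "connected (- {p u, p v})"
      using connected_open_diff_countable[of "UNIV :: complex set" "{p u, p v}"]
      by (simp add: Compl_eq_Diff_UNIV connected_UNIV)
    moreover have "open (- path_image (\<gamma> e))"
      using closed_arc_image[OF arc[OF e0(1)]] by (simp add: open_Compl)
    moreover have "- path_image (\<gamma> e) \<inter> - {p u, p v} \<noteq> {}"
    proof -
      have "p u \<in> path_image (\<gamma> e)" "p v \<in> path_image (\<gamma> e)" using pe by auto
      moreover have "path_image (\<gamma> e) \<noteq> UNIV"
        using compact_arc_image[OF arc[OF e0(1)]] not_compact_UNIV by metis
      ultimately show ?thesis by blast
    qed
    moreover have "f \<inter> - {p u, p v} \<noteq> {}"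
      using fD(3,4) pe by blast
    moreover have "f \<inter> - path_image (\<gamma> e) \<inter> - {p u, p v} = {}"
      using \<open>f \<subseteq> path_image (\<gamma> e)\<close> by blast
    ultimately show False using connectedD[of "- {p u, p v}" f "- path_image (\<gamma> e)"] fD(1) cover by blast
  qed
  have "components (- body E - inner e) =
      insert (f - inner e) (insert (f - inner e) (components (- body E) - {f}))"
    by (rule components_remove[OF open_compl_body[OF E] f(1)[unfolded faces_def]])
      (use f(2) op con ne in \<open>auto simp: e_def\<close>)
  then show "faces (insert {u, v} E) = insert (f - inner {u, v}) (faces E - {f})"
    unfolding faces_insert_eq[OF e(1)] by (simp add: faces_def e_def)
qed

lemma side_meets_face:
  assumes "E \<subseteq> E0" "f \<in> faces E" "inner e \<subseteq> f" "h \<in> sides E' e"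
  shows "h \<inter> f \<noteq> {}"
  using assms(3,4) open_Int_closure_eq_empty[OF faceD(1)[OF assms(1,2)], of h]
  unfolding sides_def by blast

lemma sides_insert_subset:
  assumes "E \<subseteq> E0" "f \<in> faces E" "inner e \<subseteq> f" "faces (insert e E) = insert X (insert Y (faces E - {f}))"
  shows "sides (insert e E) e \<subseteq> {X, Y}"
proof
  fix h assume h: "h \<in> sides (insert e E) e"
  then have "h \<inter> f \<noteq> {}" using side_meets_face[OF assms(1-3)] by blast
  then have "h \<notin> faces E - {f}" using face_disjoint[OF _ assms(2)] by blast
  then show "h \<in> {X, Y}" using h assms(4) by (auto simp: sides_def)
qed

text \<open>
  The dichotomy behind Euler's formula: a new edge either joins two components and leaves the number
  of faces alone, or closes a cycle and splits one face into its two sides.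
\<close>

lemma face_split_cases:
  assumes E: "E \<subseteq> E0" and e: "e \<in> E0" "e \<notin> E" and fin: "finite (faces E)"
  obtains (bridge) u v f X where "e = {u, v}" "(u, v) \<notin> (edge_rel E)\<^sup>*" "f \<in> faces E"
      "faces (insert e E) = insert X (faces E - {f})" "f - inner e = X" "X \<noteq> {}" "inner e \<subseteq> f"
      "sides (insert e E) e \<subseteq> {X}"
  | (cycle) C D D' f where "f \<in> faces E" "inner e \<subseteq> f" "jordan_curve C" "e \<in> C" "C \<subseteq> insert e E"
      "regions C = {D, D'}" "D \<inter> D' = {}"
      "faces (insert e E) = insert (f \<inter> D) (insert (f \<inter> D') (faces E - {f}))"
      "f \<inter> D \<noteq> {}" "f \<inter> D' \<noteq> {}" "f - inner e = (f \<inter> D) \<union> (f \<inter> D')"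
      "sides (insert e E) e = {f \<inter> D, f \<inter> D'}"
proof -
  obtain u v where uv: "u \<in> V" "v \<in> V" "u \<noteq> v" "e = {u, v}" using edge[OF e(1)] by blast
  obtain f where f: "f \<in> faces E" "inner e \<subseteq> f" using face_containing_inner[OF E e] by blast
  show ?thesis
  proof (cases "(u, v) \<in> (edge_rel E)\<^sup>*")
    case False
    note ns = face_not_split[OF E e[unfolded uv(4)] f[unfolded uv(4)] False, folded uv(4)]
    have "sides (insert e E) e \<subseteq> {f - inner e}"
      using sides_insert_subset[OF E f, of "f - inner e" "f - inner e"] ns(1) by simp
    then show ?thesis using bridge[OF uv(4) False f(1) ns(1) refl ns(2) f(2)] by blast
  next
    case True
    then obtain P W where P: "edge_path E u v P W" using reachable_edge_path uv(3) by metis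
    note cp = close_path[OF E e[unfolded uv(4)] P, folded uv(4)]
    have PE: "P \<subseteq> E" using edge_path_basics[OF P] by blast
    define D where "D = inside (img (insert e P))"
    have "D \<in> regions (insert e P)" by (simp add: D_def regions_def)
    then obtain D' where D: "D \<inter> D' = {}" "D \<union> D' = - img (insert e P)" "regions (insert e P) = {D, D'}"
      by (rule region_other[OF cp(1)])
    note fs = face_split_by_cycle[OF E e f cp(1) PE cp(2) D(3,1,2)]
    have sub: "sides (insert e E) e \<subseteq> {f \<inter> D, f \<inter> D'}"
      using sides_insert_subset[OF E f fs(1)] .
    have E': "insert e E \<subseteq> E0" and PE': "insert e P \<subseteq> insert e E" using E e PE by auto
    have fin': "finite (faces (insert e E))" unfolding fs(1) using fin by simp
    note sr = sides_at_region[OF E' fin' cp(1) PE' insertI1]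
    obtain h where h: "h \<in> sides (insert e E) e" "h \<subseteq> D" using sr[of D] D(3) by auto
    obtain h' where h': "h' \<in> sides (insert e E) e" "h' \<subseteq> D'" using sr[of D'] D(3) by auto
    have "h \<noteq> f \<inter> D'" "h' \<noteq> f \<inter> D" using h(2) h'(2) fs(2,3) D(1) by blast+
    then have "h = f \<inter> D" "h' = f \<inter> D'" using sub h(1) h'(1) by auto
    then have eq: "sides (insert e E) e = {f \<inter> D, f \<inter> D'}" using sub h(1) h'(1) by auto
    show ?thesis by (rule cycle[OF f cp(1) insertI1 PE' D(3,1) fs eq])
  qed
qed

text \<open>
  Seen from the old edges, splitting a face \<open>f\<close> only replaces it by its parts: the
  interior of the new arc, which is missing from \<open>X \<union> Y\<close>, has no limit points
  inside another arc.
\<close>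

lemma sides_insert_old:
  assumes E: "E \<subseteq> E0" and e: "e \<in> E0" "e \<notin> E" and f: "f \<in> faces E"
    and fs: "faces (insert e E) = insert X (insert Y (faces E - {f}))" "f - inner e = X \<union> Y"
    and g: "g \<in> E"
  shows "h \<in> faces E - {f} \<Longrightarrow> h \<in> sides (insert e E) g \<longleftrightarrow> h \<in> sides E g"
    "f \<in> sides E g \<longleftrightarrow> X \<in> sides (insert e E) g \<or> Y \<in> sides (insert e E) g"
proof -
  show "h \<in> faces E - {f} \<Longrightarrow> h \<in> sides (insert e E) g \<longleftrightarrow> h \<in> sides E g"
    using fs(1) by (auto simp: sides_def)
  have gE: "g \<in> E0" "g \<noteq> e" using g E e by auto
  have "closure f \<subseteq> closure X \<union> closure Y \<union> closure (inner e)"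
  proof -
    have "f \<subseteq> X \<union> Y \<union> inner e" using fs(2) by blast
    then show ?thesis using closure_mono[of f "X \<union> Y \<union> inner e"] by simp
  qed
  moreover have "closure (inner e) \<inter> inner g = {}"
    using closure_inner[OF e(1)] inner_disjoint_arc[OF gE(1) e(1) gE(2)] by blast
  moreover have "closure X \<subseteq> closure f" "closure Y \<subseteq> closure f"
    using fs(2) by (auto intro!: closure_mono)
  ultimately have "closure f \<inter> inner g \<noteq> {} \<longleftrightarrow> closure X \<inter> inner g \<noteq> {} \<or> closure Y \<inter> inner g \<noteq> {}"
    by blast
  then show "f \<in> sides E g \<longleftrightarrow> X \<in> sides (insert e E) g \<or> Y \<in> sides (insert e E) g"
    using f fs(1) by (auto simp: sides_def)
qed

lemma faces_without_edges: "faces {} = {- p ` V}"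
proof -
  have "connected (- p ` V)"
    using connected_open_diff_countable[of "UNIV :: complex set" "p ` V"] finV
    by (simp add: Compl_eq_Diff_UNIV countable_finite connected_UNIV)
  moreover have "- p ` V \<noteq> {}"
    using finV by (metis Compl_empty_eq double_complement finite_imageI infinite_UNIV_char_0)
  ultimately have "components (- p ` V) = {- p ` V}" by (simp add: components_eq_sing_iff)
  then show ?thesis by (simp add: faces_def body_def img_def)
qed

lemma finite_faces:
  assumes "E \<subseteq> E0"
  shows "finite (faces E)"
  using finite_edges[OF assms] assms
proof (induction E rule: finite_induct)
  case empty
  show ?case by (simp add: faces_without_edges)
next
  case (insert e E)
  then have *: "E \<subseteq> E0" "e \<in> E0" "e \<notin> E" "finite (faces E)" by auto
  show ?case
  proof (cases rule: face_split_cases[OF *])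
    case (1 u v f X)
    then show ?thesis using *(4) by simp
  next
    case (2 C D D' f)
    then show ?thesis using *(4) by simp
  qed
qed

text \<open>
  Regard \<open>g\<close> as the edge added last: its sides are among the parts of the face that it
  splits.
\<close>

lemma at_most_two_sides:
  assumes "E \<subseteq> E0" "g \<in> E"
  shows "\<exists>X Y. sides E g \<subseteq> {X, Y}"
proof -
  have *: "E - {g} \<subseteq> E0" "g \<in> E0" "g \<notin> E - {g}" "insert g (E - {g}) = E" using assms by auto
  show ?thesis
  proof (cases rule: face_split_cases[OF *(1-3) finite_faces[OF *(1)]])
    case (1 u v f X)
    then have "sides E g \<subseteq> {X, X}" using *(4) by simp
    then show ?thesis by blast
  next
    case (2 C D D' f)
    then have "sides E g = {f \<inter> D, f \<inter> D'}" using *(4) by simp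
    then show ?thesis by blast
  qed
qed

lemma boundary_two_sides:
  assumes "g \<in> E" "sides E g = {h, h'}" "h \<noteq> h'"
  shows "g \<in> boundary E k \<longleftrightarrow> k = h \<or> k = h'"
proof -
  have "g \<in> boundary E k \<longleftrightarrow> k \<in> {h, h'} \<and> (\<exists>k'\<in>{h, h'}. k' \<noteq> k)"
    unfolding assms(2)[symmetric] using assms(1) by (simp add: boundary_def)
  then show ?thesis using assms(3) by blast
qed

text \<open>
  Modulo 2, a cycle is the sum of the boundaries of the faces on one side of it: an edge of the
  cycle has exactly one of its two faces on that side, and any other edge has both or none.
\<close>

lemma jordan_curve_sum_of_boundaries:
  assumes E: "E \<subseteq> E0" and C: "jordan_curve C" "C \<subseteq> E" and D: "D \<in> regions C" and g: "g \<in> E"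
  shows "g \<in> C \<longleftrightarrow> odd (card {h \<in> {h \<in> faces E. h \<subseteq> D}. g \<in> boundary E h})"
proof -
  obtain X Y where XY: "sides E g \<subseteq> {X, Y}" using at_most_two_sides[OF E g] by blast
  have ne: "h \<noteq> {}" if "h \<in> sides E g" for h using faceD(3)[OF E] that by (auto simp: sides_def)
  let ?S = "{h \<in> {h \<in> faces E. h \<subseteq> D}. g \<in> boundary E h}"
  show ?thesis
  proof (cases "g \<in> C")
    case True
    obtain D' where D': "D' \<in> regions C" "D \<inter> D' = {}" using region_other[OF C(1) D] by metis
    obtain h where h: "h \<in> sides E g" "h \<subseteq> D"
      using sides_at_region[OF E finite_faces[OF E] C True D] by blast
    obtain h' where h': "h' \<in> sides E g" "h' \<subseteq> D'"
      using sides_at_region[OF E finite_faces[OF E] C True D'(1)] by blast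
    have "h \<noteq> h'" and nD: "\<not> h' \<subseteq> D" using h h' D'(2) ne by blast+
    then have s: "sides E g = {h, h'}" using XY h(1) h'(1) by blast
    have "g \<in> boundary E k \<longleftrightarrow> k = h \<or> k = h'" for k
      by (rule boundary_two_sides[OF g s \<open>h \<noteq> h'\<close>])
    moreover have "h \<in> faces E" using h(1) by (simp add: sides_def)
    ultimately have "?S = {h}" using h(2) nD by auto
    then show ?thesis using True by simp
  next
    case False
    obtain D' where D': "D' \<in> regions C" "\<forall>h \<in> sides E g. h \<subseteq> D'"
      using sides_in_region[OF E C] g False by blast
    have "even (card ?S)"
    proof (cases "D' = D \<and> (\<exists>h \<in> sides E g. \<exists>h' \<in> sides E g. h' \<noteq> h)")
      case True
      then obtain h h' where h: "h \<in> sides E g" "h' \<in> sides E g" "h' \<noteq> h" by blast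
      then have s: "sides E g = {h, h'}" using XY by blast
      have "g \<in> boundary E k \<longleftrightarrow> k = h \<or> k = h'" for k
        by (rule boundary_two_sides[OF g s h(3)[symmetric]])
      moreover have "h \<in> faces E" "h' \<in> faces E" using h by (auto simp: sides_def)
      moreover have "h \<subseteq> D" "h' \<subseteq> D" using h True D' by auto
      ultimately have "?S = {h, h'}" by auto
      then show ?thesis using h(3) by simp
    next
      case False
      have "?S = {}"
      proof (rule ccontr)
        assume "?S \<noteq> {}"
        then obtain h where h: "h \<subseteq> D" "h \<in> sides E g" "\<exists>h' \<in> sides E g. h' \<noteq> h"
          by (auto simp: boundary_def)
        obtain x where x: "x \<in> h" using ne[OF h(2)] by auto
        have "h \<subseteq> D'" using D'(2) h(2) by simp
        then have "x \<in> D' \<inter> D" using x h(1) by auto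
        then have "D' = D" using regions_disjoint[OF C(1) D'(1) D] by auto
        then show False using False h(2,3) by auto
      qed
      then have "card ?S = 0" by (simp only: card.empty)
      then show ?thesis by (simp only: dvd_0_right)
    qed
    then show ?thesis using False by simp
  qed
qed

section \<open>A basis of the cycle space that uses every edge at most twice\<close>

text \<open>
  Connectivity of the dual graph. In algebraic terms: no proper nonempty subfamily of the face
  boundaries sums to zero.
\<close>

definition linked :: "'a set set \<Rightarrow> bool" where
  "linked E \<longleftrightarrow> (\<forall>S. S \<subseteq> faces E \<longrightarrow> S \<noteq> {} \<longrightarrow> S \<noteq> faces E \<longrightarrow>
     (\<exists>g \<in> E. \<exists>h \<in> sides E g. \<exists>h' \<in> sides E g. h \<in> S \<and> h' \<notin> S))"

lemma boundary_insert_old: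
  assumes E: "E \<subseteq> E0" and e: "e \<in> E0" "e \<notin> E" and f: "f \<in> faces E"
    and fs: "faces (insert e E) = insert X (insert Y (faces E - {f}))" "f - inner e = X \<union> Y"
    and XY: "X \<notin> faces E - {f}" "Y \<notin> faces E - {f}" "sides (insert e E) e \<subseteq> {X, Y}"
    and h: "h \<in> faces E - {f}"
  shows "boundary (insert e E) h = boundary E h"
proof -
  have "e \<notin> boundary (insert e E) h" using h XY by (auto simp: boundary_def)
  moreover have "g \<in> boundary (insert e E) h \<longleftrightarrow> g \<in> boundary E h" if g: "g \<in> E" for g
  proof -
    note old = sides_insert_old[OF E e f fs g]
    have sub: "sides E g \<subseteq> faces E" "sides (insert e E) g \<subseteq> insert X (insert Y (faces E - {f}))"
      using fs(1) by (auto simp: sides_def)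
    have "h \<noteq> X" "h \<noteq> Y" "h \<noteq> f" using XY h by auto
    have "(\<exists>h' \<in> sides (insert e E) g. h' \<noteq> h) \<longleftrightarrow> (\<exists>h' \<in> sides E g. h' \<noteq> h)" (is "?L \<longleftrightarrow> ?R")
    proof
      assume ?L
      then obtain h' where h': "h' \<in> sides (insert e E) g" "h' \<noteq> h" by blast
      show ?R
      proof (cases "h' \<in> faces E - {f}")
        case True
        then show ?thesis using old(1) h' by blast
      next
        case False
        then have "h' = X \<or> h' = Y" using h'(1) sub by blast
        then have "f \<in> sides E g" using old(2) h'(1) by blast
        then show ?thesis using \<open>h \<noteq> f\<close> by blast
      qed
    next
      assume ?R
      then obtain h' where h': "h' \<in> sides E g" "h' \<noteq> h" by blast
      show ?L
      proof (cases "h' = f")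
        case True
        then show ?thesis using old(2) h'(1) \<open>h \<noteq> X\<close> \<open>h \<noteq> Y\<close> by blast
      next
        case False
        then have "h' \<in> faces E - {f}" using h'(1) sub by blast
        then show ?thesis using old(1) h' by blast
      qed
    qed
    then show ?thesis using old(1)[OF h] g by (simp add: boundary_def)
  qed
  moreover have "boundary E h \<subseteq> E" "boundary (insert e E) h \<subseteq> insert e E" by (auto simp: boundary_def)
  ultimately show ?thesis by blast
qed

lemma boundary_insert_bridge:
  assumes E: "E \<subseteq> E0" and e: "e \<in> E0" "e \<notin> E" and f: "f \<in> faces E"
    and fs: "faces (insert e E) = insert X (faces E - {f})" "f - inner e = X"
    and X: "X \<notin> faces E - {f}" "sides (insert e E) e \<subseteq> {X}"
  shows "boundary (insert e E) X = boundary E f"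
proof -
  have fs': "faces (insert e E) = insert X (insert X (faces E - {f}))" "f - inner e = X \<union> X"
    using fs by auto
  have "e \<notin> boundary (insert e E) X" using X(2) by (auto simp: boundary_def)
  moreover have "g \<in> boundary (insert e E) X \<longleftrightarrow> g \<in> boundary E f" if g: "g \<in> E" for g
  proof -
    note old = sides_insert_old[OF E e f fs' g]
    have sub: "sides E g \<subseteq> faces E" "sides (insert e E) g \<subseteq> insert X (faces E - {f})"
      using fs(1) by (auto simp: sides_def)
    have "(\<exists>h' \<in> sides (insert e E) g. h' \<noteq> X) \<longleftrightarrow> (\<exists>h' \<in> sides E g. h' \<noteq> f)" (is "?L \<longleftrightarrow> ?R")
    proof
      assume ?L
      then obtain h' where h': "h' \<in> sides (insert e E) g" "h' \<noteq> X" by blast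
      then have m: "h' \<in> faces E - {f}" using sub by blast
      then have "h' \<noteq> f" "h' \<in> sides E g" using old(1)[OF m] h'(1) by simp_all
      then show ?R by (intro bexI[of _ h'])
    next
      assume ?R
      then obtain h' where h': "h' \<in> sides E g" "h' \<noteq> f" by blast
      then have m: "h' \<in> faces E - {f}" using sub by blast
      then have "h' \<noteq> X" using X(1) by metis
      moreover have "h' \<in> sides (insert e E) g" using old(1)[OF m] h'(1) by simp
      ultimately show ?L by (intro bexI[of _ h'])
    qed
    then show ?thesis using old(2) g by (simp add: boundary_def)
  qed
  moreover have "boundary E f \<subseteq> E" "boundary (insert e E) X \<subseteq> insert e E" by (auto simp: boundary_def)
  ultimately show ?thesis by blast
qed

lemma linked_insert:
  assumes E: "E \<subseteq> E0" and e: "e \<in> E0" "e \<notin> E" and f: "f \<in> faces E"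
    and fs: "faces (insert e E) = insert X (insert Y (faces E - {f}))" "f - inner e = X \<union> Y"
    and XY: "X \<notin> faces E - {f}" "Y \<notin> faces E - {f}" "X \<noteq> Y \<Longrightarrow> sides (insert e E) e = {X, Y}"
    and lnk: "linked E"
  shows "linked (insert e E)"
  unfolding linked_def
proof (intro allI impI)
  fix S assume S: "S \<subseteq> faces (insert e E)" "S \<noteq> {}" "S \<noteq> faces (insert e E)"
  show "\<exists>g \<in> insert e E. \<exists>h \<in> sides (insert e E) g. \<exists>h' \<in> sides (insert e E) g. h \<in> S \<and> h' \<notin> S"
  proof (cases "X \<in> S \<longleftrightarrow> Y \<in> S")
    case False
    then have "sides (insert e E) e = {X, Y}" using XY(3) by auto
    then show ?thesis using False by blast
  next
    case True
    \<comment> \<open>the corresponding set of faces before the edge was added\<close>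
    define T where "T = (S - {X, Y}) \<union> (if X \<in> S then {f} else {})"
    have mem: "h \<in> T \<longleftrightarrow> h \<in> S" if "h \<in> faces E - {f}" for h
      using that XY(1,2) by (auto simp: T_def)
    have memf: "f \<in> T \<longleftrightarrow> X \<in> S"
    proof
      assume "f \<in> T"
      show "X \<in> S"
      proof (rule ccontr)
        assume n: "X \<notin> S"
        then have "f \<in> S" "f \<noteq> X" "f \<noteq> Y" using \<open>f \<in> T\<close> by (auto simp: T_def)
        then show False using S(1) fs(1) by auto
      qed
    qed (simp add: T_def)
    have "T \<subseteq> faces E" using S(1) f fs(1) by (auto simp: T_def split: if_splits)
    moreover have "T \<noteq> {}"
    proof -
      obtain h where "h \<in> S" using S(2) by blast
      then show ?thesis using True by (auto simp: T_def)
    qed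
    moreover have "T \<noteq> faces E"
    proof
      assume T: "T = faces E"
      then have "X \<in> S" using f memf by blast
      moreover have "faces E - {f} \<subseteq> S" using T mem by blast
      ultimately have "faces (insert e E) \<subseteq> S" unfolding fs(1) using True by simp
      then show False using S(1,3) by simp
    qed
    ultimately obtain g h h' where g: "g \<in> E" and h: "h \<in> sides E g" "h \<in> T" and h': "h' \<in> sides E g" "h' \<notin> T"
      using lnk unfolding linked_def by blast
    note old = sides_insert_old[OF E e f fs g]
    have hf: "h \<in> faces E" "h' \<in> faces E" using h h' by (auto simp: sides_def)
    have "\<exists>k \<in> sides (insert e E) g. k \<in> S"
    proof (cases "h = f")
      case True
      then show ?thesis using old(2) h memf \<open>X \<in> S \<longleftrightarrow> Y \<in> S\<close> by blast
    next
      case False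
      then show ?thesis using old(1)[of h] h hf mem by blast
    qed
    moreover have "\<exists>k \<in> sides (insert e E) g. k \<notin> S"
    proof (cases "h' = f")
      case True
      then show ?thesis using old(2) h' memf \<open>X \<in> S \<longleftrightarrow> Y \<in> S\<close> by blast
    next
      case False
      then show ?thesis using old(1)[of h'] h' hf mem by blast
    qed
    ultimately show ?thesis using g by blast
  qed
qed

text \<open>
  The vertex sets of the connected components; their number enters Euler's formula.
\<close>

definition reach_classes :: "'a set set \<Rightarrow> 'a set set" where
  "reach_classes E = (\<lambda>x. (edge_rel E)\<^sup>* `` {x}) ` V"

lemma reach_classes_insert:
  "reach_classes (insert e E) = (\<lambda>c. (edge_rel (insert e E))\<^sup>* `` c) ` reach_classes E"
proof -
  have "edge_rel E \<subseteq> edge_rel (insert e E)" by (auto simp: edge_rel_def)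
  then have sub: "(edge_rel E)\<^sup>* \<subseteq> (edge_rel (insert e E))\<^sup>*" by (rule rtrancl_mono)
  have "(edge_rel (insert e E))\<^sup>* `` {x} = (edge_rel (insert e E))\<^sup>* `` ((edge_rel E)\<^sup>* `` {x})" for x
    using sub by (blast intro: rtrancl_trans)
  then show ?thesis unfolding reach_classes_def by auto
qed

lemma card_reach_classes_insert:
  "card (reach_classes (insert e E)) \<le> card (reach_classes E)"
  unfolding reach_classes_insert using finV by (intro card_image_le) (simp add: reach_classes_def)

lemma card_reach_classes_bridge:
  assumes "u \<in> V" "v \<in> V" "u \<noteq> v" "(u, v) \<notin> (edge_rel E)\<^sup>*"
  shows "card (reach_classes (insert {u, v} E)) < card (reach_classes E)"
proof -
  let ?R = "(edge_rel E)\<^sup>*" and ?R' = "(edge_rel (insert {u, v} E))\<^sup>*"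
  have fin: "finite (reach_classes E)" using finV by (simp add: reach_classes_def)
  have "(u, v) \<in> ?R'" using assms(3) by (intro r_into_rtrancl) (simp add: edge_rel_def)
  moreover have "(v, u) \<in> ?R'" using calculation sym_edge_rel by (metis symD)
  ultimately have eq: "?R' `` {u} = ?R' `` {v}" by (blast intro: rtrancl_trans)
  have "edge_rel E \<subseteq> edge_rel (insert {u, v} E)" by (auto simp: edge_rel_def)
  then have sub: "?R \<subseteq> ?R'" by (rule rtrancl_mono)
  have idem: "?R' `` (?R `` {x}) = ?R' `` {x}" for x using sub by (blast intro: rtrancl_trans)
  have "\<not> inj_on (\<lambda>c. ?R' `` c) (reach_classes E)"
  proof
    assume "inj_on (\<lambda>c. ?R' `` c) (reach_classes E)"
    then have "?R `` {u} = ?R `` {v}"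
      by (rule inj_onD) (use idem eq assms(1,2) in \<open>auto simp: reach_classes_def\<close>)
    then show False using assms(4) by blast
  qed
  then have "card ((\<lambda>c. ?R' `` c) ` reach_classes E) \<noteq> card (reach_classes E)"
    using eq_card_imp_inj_on[OF fin] by blast
  then show ?thesis
    unfolding reach_classes_insert using card_image_le[OF fin, of "\<lambda>c. ?R' `` c"] by linarith
qed

text \<open>
  The boundaries of the faces on one side \<open>D\<close> of a cycle add up to the cycle, so a
  single face among them cannot fail to have an even boundary. It is applied to the one new face
  \<open>X\<close> on this side.
\<close>

lemma even_boundary_cycle:
  assumes E: "E \<subseteq> E0" and C: "jordan_curve C" "C \<subseteq> E" and D: "D \<in> regions C"
    and X: "X \<in> faces E" "X \<subseteq> D"
    and ev: "\<And>h. h \<in> faces E \<Longrightarrow> h \<subseteq> D \<Longrightarrow> h \<noteq> X \<Longrightarrow> even_edges (boundary E h)"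
  shows "even_edges (boundary E X)"
proof (rule even_edges_transfer[where S = "{h \<in> faces E. h \<subseteq> D}" and E = E and C = C])
  show "finite {h \<in> faces E. h \<subseteq> D}" using finite_faces[OF E] by simp
  show "finite E" by (rule finite_edges[OF E])
  show "g \<in> C \<longleftrightarrow> odd (card {h \<in> {h \<in> faces E. h \<subseteq> D}. g \<in> boundary E h})" if "g \<in> E" for g
    by (rule jordan_curve_sum_of_boundaries[OF E C D that])
  show "boundary E h \<subseteq> E" for h by (auto simp: boundary_def)
  show "C \<subseteq> E" by fact
  show "even_edges C" using C(1) by (simp add: jordan_curve_def)
  show "X \<in> {h \<in> faces E. h \<subseteq> D}" using X by simp
  show "even_edges (boundary E h)" if "h \<in> {h \<in> faces E. h \<subseteq> D}" "h \<noteq> X" for h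
    using ev that by simp
qed

text \<open>
  The last conjunct is the inequality in Euler's formula that is needed. When an edge closes a
  cycle, each of the two new faces is the only new one on its side of the cycle, so both get even
  boundaries.
\<close>

lemma boundary_invariants:
  assumes "E \<subseteq> E0"
  shows "(\<forall>h \<in> faces E. even_edges (boundary E h)) \<and> linked E \<and>
    card E + 1 + card (reach_classes E) \<le> card (faces E) + card V"
  using finite_edges[OF assms] assms
proof (induction E rule: finite_induct)
  case empty
  have "card (reach_classes {}) \<le> card V"
    unfolding reach_classes_def by (rule card_image_le[OF finV])
  moreover have "linked {}" unfolding linked_def faces_without_edges by blast
  ultimately show ?case unfolding faces_without_edges by (simp add: boundary_def even_edges_def)
next
  case (insert e E)
  then have E: "E \<subseteq> E0" and e: "e \<in> E0" "e \<notin> E" and E': "insert e E \<subseteq> E0" by auto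
  note fin = finite_faces[OF E]
  have IH: "\<And>h. h \<in> faces E \<Longrightarrow> even_edges (boundary E h)" "linked E"
    "card E + 1 + card (reach_classes E) \<le> card (faces E) + card V"
    using insert.IH[OF E] by auto
  have cE: "card (insert e E) = card E + 1" using e(2) finite_edges[OF E] by simp
  have sub_notin: "Z \<notin> faces E - {f}" if "Z \<subseteq> f" "Z \<noteq> {}" "f \<in> faces E" for Z f
    using that face_disjoint[of Z E f] by auto
  show ?case
  proof (cases rule: face_split_cases[OF E e fin])
    case (1 u v f X)
    have X: "X \<notin> faces E - {f}" by (rule sub_notin) (use 1 in auto)
    have fs: "faces (insert e E) = insert X (insert X (faces E - {f}))" "f - inner e = X \<union> X"
      using 1 by auto
    have s: "sides (insert e E) e \<subseteq> {X, X}" using 1 by auto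
    have "even_edges (boundary (insert e E) h)" if "h \<in> faces (insert e E)" for h
    proof (cases "h = X")
      case True
      then show ?thesis
        using boundary_insert_bridge[OF E e 1(3,4,5) X 1(8)] IH(1)[OF 1(3)] by simp
    next
      case False
      then have "h \<in> faces E - {f}" using that fs(1) by auto
      then show ?thesis using boundary_insert_old[OF E e 1(3) fs X X s] IH(1) by auto
    qed
    moreover have "linked (insert e E)"
      by (rule linked_insert[OF E e 1(3) fs X X _ IH(2)]) simp
    moreover have "card (faces (insert e E)) = card (faces E)"
    proof -
      have "card (faces (insert e E)) = Suc (card (faces E - {f}))"
        unfolding 1(4) using X fin by simp
      then show ?thesis using card_Suc_Diff1[OF fin 1(3)] by simp
    qed
    moreover have "card (reach_classes (insert e E)) < card (reach_classes E)"
    proof -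
      obtain a b where ab: "a \<in> V" "b \<in> V" "a \<noteq> b" "e = {a, b}" using edge[OF e(1)] by blast
      then have "u \<in> V" "v \<in> V" "u \<noteq> v" using 1(1) by (auto simp: doubleton_eq_iff)
      then show ?thesis using card_reach_classes_bridge[of u v E] 1(1,2) by simp
    qed
    ultimately show ?thesis using IH(3) cE by auto
  next
    case (2 C D D' f)
    define X where "X = f \<inter> D"
    define Y where "Y = f \<inter> D'"
    have fs: "faces (insert e E) = insert X (insert Y (faces E - {f}))" "f - inner e = X \<union> Y"
      using 2 by (auto simp: X_def Y_def)
    have ne: "X \<noteq> {}" "Y \<noteq> {}" "X \<inter> Y = {}" using 2 by (auto simp: X_def Y_def)
    have X: "X \<notin> faces E - {f}" by (rule sub_notin) (use ne 2 in \<open>auto simp: X_def\<close>)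
    have Y: "Y \<notin> faces E - {f}" by (rule sub_notin) (use ne 2 in \<open>auto simp: Y_def\<close>)
    have s: "sides (insert e E) e = {X, Y}" using 2 by (simp add: X_def Y_def)
    have old: "even_edges (boundary (insert e E) h)" if "h \<in> faces E - {f}" for h
      using boundary_insert_old[OF E e 2(1) fs X Y _ that] s IH(1) that by simp
    have bX: "even_edges (boundary (insert e E) X)"
    proof (rule even_boundary_cycle[OF E' 2(3,5)])
      show "D \<in> regions C" using 2(6) by simp
      show "X \<in> faces (insert e E)" "X \<subseteq> D" using fs by (auto simp: X_def)
      fix h assume h: "h \<in> faces (insert e E)" "h \<subseteq> D" "h \<noteq> X"
      have "h \<noteq> Y" using h(2) ne(2) 2(7) by (auto simp: Y_def)
      then show "even_edges (boundary (insert e E) h)" using old h fs(1) by auto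
    qed
    have bY: "even_edges (boundary (insert e E) Y)"
    proof (rule even_boundary_cycle[OF E' 2(3,5)])
      show "D' \<in> regions C" using 2(6) by simp
      show "Y \<in> faces (insert e E)" "Y \<subseteq> D'" using fs by (auto simp: Y_def)
      fix h assume h: "h \<in> faces (insert e E)" "h \<subseteq> D'" "h \<noteq> Y"
      have "h \<noteq> X" using h(2) ne(1) 2(7) by (auto simp: X_def)
      then show "even_edges (boundary (insert e E) h)" using old h fs(1) by auto
    qed
    have "\<forall>h \<in> faces (insert e E). even_edges (boundary (insert e E) h)"
      unfolding fs(1) using bX bY old by auto
    moreover have "linked (insert e E)"
      by (rule linked_insert[OF E e 2(1) fs X Y s IH(2)])
    moreover have "card (faces (insert e E)) = card (faces E) + 1"
    proof -
      have "X \<noteq> Y" using ne by auto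
      then have "card (faces (insert e E)) = Suc (Suc (card (faces E - {f})))"
        unfolding fs(1) using X Y fin by simp
      then show ?thesis using card_Suc_Diff1[OF fin 2(1)] by simp
    qed
    ultimately show ?thesis using IH(3) cE card_reach_classes_insert[of e E] by auto
  qed
qed

text \<open>
  All face boundaries together sum to zero; leaving out one face makes the family independent.
  Independence is stated in the form in which it is used: a nonempty subfamily has an edge that lies
  in exactly one of its members.
\<close>

theorem planar_two_basis:
  assumes "V \<noteq> {}"
  shows "\<exists>B. finite B \<and> (\<forall>Z \<in> B. Z \<subseteq> E0 \<and> even_edges Z) \<and>
    (\<forall>g \<in> E0. card {Z \<in> B. g \<in> Z} \<le> 2) \<and>
    (\<forall>S \<subseteq> B. S \<noteq> {} \<longrightarrow> (\<exists>g. card {Z \<in> S. g \<in> Z} = 1)) \<and>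
    card E0 + 1 \<le> card B + card V"
proof -
  note inv = boundary_invariants[OF order_refl]
  note fin = finite_faces[OF order_refl]
  have rc: "card (reach_classes E0) \<ge> 1"
    using assms finV by (simp add: Suc_leI card_gt_0_iff reach_classes_def)
  have sep: "\<exists>g k. g \<in> E0 \<and> k \<in> S \<and> (\<forall>h \<in> S. g \<in> boundary E0 h \<longleftrightarrow> h = k)"
    if S: "S \<subseteq> faces E0" "S \<noteq> {}" "S \<noteq> faces E0" for S
  proof -
    obtain g h h' where g: "g \<in> E0" "h \<in> sides E0 g" "h' \<in> sides E0 g" "h \<in> S" "h' \<notin> S"
      using inv S unfolding linked_def by blast
    obtain X Y where "sides E0 g \<subseteq> {X, Y}" using at_most_two_sides[OF order_refl g(1)] by blast
    then have "sides E0 g = {h, h'}" "h \<noteq> h'" using g by auto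
    then have "g \<in> boundary E0 k \<longleftrightarrow> k = h \<or> k = h'" for k using boundary_two_sides[OF g(1)] by blast
    then show ?thesis using g by blast
  qed
  have "faces E0 \<noteq> {}"
  proof
    assume "faces E0 = {}"
    then have "- body E0 = {}" by (simp add: faces_def)
    then show False using compact_body[OF order_refl] not_compact_UNIV by (metis Compl_empty_eq double_complement)
  qed
  then obtain h0 where h0: "h0 \<in> faces E0" by blast
  let ?F = "faces E0 - {h0}"
  have inj: "inj_on (boundary E0) ?F"
  proof (rule inj_onI, rule ccontr)
    fix h h' assume h: "h \<in> ?F" "h' \<in> ?F" "boundary E0 h = boundary E0 h'" "h \<noteq> h'"
    then show False using sep[of "{h, h'}"] h0 by auto
  qed
  have "card (boundary E0 ` ?F) + 1 = card (faces E0)"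
    using card_image[OF inj] card_Suc_Diff1[OF fin h0] by simp
  then have "card E0 + 1 \<le> card (boundary E0 ` ?F) + card V" using inv rc by linarith
  moreover have "card {Z \<in> boundary E0 ` ?F. g \<in> Z} \<le> 2" if g: "g \<in> E0" for g
  proof -
    obtain X Y where XY: "sides E0 g \<subseteq> {X, Y}" using at_most_two_sides[OF order_refl g] by blast
    have "{Z \<in> boundary E0 ` ?F. g \<in> Z} \<subseteq> boundary E0 ` {X, Y}"
    proof
      fix Z assume "Z \<in> {Z \<in> boundary E0 ` ?F. g \<in> Z}"
      then obtain h where h: "Z = boundary E0 h" "g \<in> boundary E0 h" by blast
      then have "h \<in> sides E0 g" by (simp add: boundary_def)
      then have "h \<in> {X, Y}" using XY by (rule rev_subsetD)
      then show "Z \<in> boundary E0 ` {X, Y}" unfolding h(1) by (rule imageI)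
    qed
    then have "card {Z \<in> boundary E0 ` ?F. g \<in> Z} \<le> card (boundary E0 ` {X, Y})"
      by (intro card_mono) auto
    also have "\<dots> \<le> card {X, Y}" by (rule card_image_le) simp
    also have "\<dots> \<le> 2" by (simp add: card_insert_if)
    finally show ?thesis .
  qed
  moreover have "\<exists>g. card {Z \<in> S. g \<in> Z} = 1" if S: "S \<subseteq> boundary E0 ` ?F" "S \<noteq> {}" for S
  proof -
    let ?T = "{h \<in> ?F. boundary E0 h \<in> S}"
    have "?T \<noteq> {}" using S by blast
    moreover have "?T \<noteq> faces E0" using h0 by blast
    ultimately obtain g k where gk: "k \<in> ?T" "\<forall>h \<in> ?T. g \<in> boundary E0 h \<longleftrightarrow> h = k"
      using sep[of ?T] by blast
    have "{Z \<in> S. g \<in> Z} = {boundary E0 k}"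
    proof
      show "{Z \<in> S. g \<in> Z} \<subseteq> {boundary E0 k}"
      proof
        fix Z assume Z: "Z \<in> {Z \<in> S. g \<in> Z}"
        then obtain h where "h \<in> ?T" "Z = boundary E0 h" using S(1) by blast
        then show "Z \<in> {boundary E0 k}" using gk(2) Z by auto
      qed
      show "{boundary E0 k} \<subseteq> {Z \<in> S. g \<in> Z}" using gk by auto
    qed
    then have "card {Z \<in> S. g \<in> Z} = 1" by (simp only: card_1_singleton_iff) auto
    then show ?thesis ..
  qed
  ultimately show ?thesis
    using inv fin by (intro exI[of _ "boundary E0 ` ?F"]) (auto simp: boundary_def)
qed

end

section \<open>Neighbors in the square of a graph\<close>

definition nbs :: "'a set set \<Rightarrow> 'a \<Rightarrow> 'a set" where
  "nbs E v = {w. w \<noteq> v \<and> {v, w} \<in> E}"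

definition sq :: "'a set set \<Rightarrow> 'a \<Rightarrow> 'a set" where
  "sq E v = {w. w \<noteq> v \<and> (w \<in> nbs E v \<or> nbs E v \<inter> nbs E w \<noteq> {})}"

definition square_colorable :: "'a set set \<Rightarrow> ('a \<Rightarrow> 'c set) \<Rightarrow> 'a set \<Rightarrow> bool" where
  "square_colorable E L W \<longleftrightarrow>
     (\<exists>c. (\<forall>v \<in> W. c v \<in> L v) \<and> (\<forall>v \<in> W. \<forall>w \<in> W. w \<in> sq E v \<longrightarrow> c v \<noteq> c w))"

lemma nbs_sym: "w \<in> nbs E v \<longleftrightarrow> v \<in> nbs E w"
  by (auto simp: nbs_def insert_commute)

lemma sq_sym: "w \<in> sq E v \<longleftrightarrow> v \<in> sq E w"
  using nbs_sym[of w E v] by (auto simp: sq_def)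

text \<open>
  A finite simple graph with maximum degree at most 4, given by its edge set.
\<close>

locale graph4 =
  fixes V :: "'a set" and E :: "'a set set"
  assumes finV: "finite V"
    and edges: "e \<in> E \<Longrightarrow> \<exists>u v. u \<in> V \<and> v \<in> V \<and> u \<noteq> v \<and> e = {u, v}"
    and deg4: "card (nbs E v) \<le> 4"
begin

abbreviation N :: "'a \<Rightarrow> 'a set" where "N \<equiv> nbs E"
abbreviation N2 :: "'a \<Rightarrow> 'a set" where "N2 \<equiv> sq E"
abbreviation deg :: "'a \<Rightarrow> nat" where "deg v \<equiv> card (N v)"

lemma edge_cases:
  assumes "e \<in> E" obtains u v where "u \<in> V" "v \<in> V" "u \<noteq> v" "e = {u, v}"
  using edges[OF assms] by blast

lemma N_V: "N v \<subseteq> V"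
proof
  fix w assume "w \<in> N v"
  then have "{v, w} \<in> E" by (simp add: nbs_def)
  then show "w \<in> V" by (elim edge_cases) (auto simp: doubleton_eq_iff)
qed

lemma finN: "finite (N v)"
  using N_V finV finite_subset by blast

lemma finE: "finite E"
proof (rule finite_subset)
  show "E \<subseteq> Pow V" using edges by blast
qed (simp add: finV)

lemma N2_V: "N2 v \<subseteq> V"
proof
  fix w assume "w \<in> N2 v"
  then have "w \<in> N v \<or> (\<exists>z. z \<in> N w)" by (auto simp: sq_def)
  then show "w \<in> V"
  proof
    assume "\<exists>z. z \<in> N w"
    then obtain z where "w \<in> N z" using nbs_sym by fast
    then show ?thesis using N_V by blast
  qed (use N_V in blast)
qed

lemma finN2: "finite (N2 v)"
  using N2_V finV finite_subset by blast

lemma N_edge: "w \<in> N v \<Longrightarrow> {v, w} \<in> E"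
  by (simp add: nbs_def)

lemma edge_N: "{v, w} \<in> E \<Longrightarrow> v \<noteq> w \<Longrightarrow> w \<in> N v"
  by (auto simp: nbs_def)

lemma edge_at:
  assumes "e \<in> E" "v \<in> e"
  obtains w where "w \<in> N v" "e = {v, w}"
proof -
  obtain a b where ab: "a \<noteq> b" "e = {a, b}" using assms(1) by (elim edge_cases)
  show ?thesis
  proof (cases "v = a")
    case True
    then show ?thesis using that[of b] ab assms(1) by (simp add: nbs_def)
  next
    case False
    then have "v = b" using assms(2) ab by simp
    then show ?thesis using that[of a] ab assms(1) by (simp add: nbs_def insert_commute)
  qed
qed

lemma card_edges_at: "card {e \<in> E. v \<in> e} = deg v"
proof -
  have "{e \<in> E. v \<in> e} = (\<lambda>w. {v, w}) ` N v"
  proof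
    show "{e \<in> E. v \<in> e} \<subseteq> (\<lambda>w. {v, w}) ` N v"
    proof
      fix e assume e: "e \<in> {e \<in> E. v \<in> e}"
      then obtain w where "w \<in> N v" "e = {v, w}" using edge_at[of e v] by blast
      then show "e \<in> (\<lambda>w. {v, w}) ` N v" by simp
    qed
  qed (auto simp: nbs_def)
  moreover have "inj_on (\<lambda>w. {v, w}) (N v)" by (auto simp: inj_on_def doubleton_eq_iff)
  ultimately show ?thesis by (simp add: card_image)
qed

lemma double_count:
  assumes "finite A" "finite B"
  shows "(\<Sum>a\<in>A. card {b \<in> B. P a b}) = (\<Sum>b\<in>B. card {a \<in> A. P a b})"
  using sum.swap_restrict[OF assms, of "\<lambda>_ _. 1 :: nat" P] by simp

text \<open>
  The number of triangles at \<open>u\<close>.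
\<close>

definition inner_edges :: "'a \<Rightarrow> nat" where
  "inner_edges u = card {e \<in> E. e \<subseteq> N u}"

definition common :: "'a \<Rightarrow> 'a \<Rightarrow> nat" where
  "common u x = card (N u \<inter> N x)"

text \<open>
  Each triangle at \<open>u\<close> wastes two of the second steps from \<open>u\<close>, and a
  vertex \<open>x\<close> at distance 2 that is reached in \<open>common u x\<close> ways wastes all
  of them but one.
\<close>

definition defect :: "'a \<Rightarrow> nat" where
  "defect u = 2 * inner_edges u + (\<Sum>x \<in> N2 u - N u. common u x - 1)"

lemma sum_common_N: "(\<Sum>a\<in>N u. common u a) = 2 * inner_edges u"
proof -
  let ?F = "{e \<in> E. e \<subseteq> N u}"
  have "common u a = card {e \<in> ?F. a \<in> e}" if a: "a \<in> N u" for a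
  proof -
    have "{e \<in> ?F. a \<in> e} = (\<lambda>w. {a, w}) ` (N u \<inter> N a)"
    proof
      show "{e \<in> ?F. a \<in> e} \<subseteq> (\<lambda>w. {a, w}) ` (N u \<inter> N a)"
      proof
        fix e assume e: "e \<in> {e \<in> ?F. a \<in> e}"
        then obtain w where "w \<in> N a" "e = {a, w}" using edge_at[of e a] by blast
        then show "e \<in> (\<lambda>w. {a, w}) ` (N u \<inter> N a)" using e by simp
      qed
    qed (use a in \<open>auto simp: nbs_def\<close>)
    moreover have "inj_on (\<lambda>w. {a, w}) (N u \<inter> N a)" by (auto simp: inj_on_def doubleton_eq_iff)
    ultimately show ?thesis by (simp add: card_image common_def)
  qed
  then have "(\<Sum>a\<in>N u. common u a) = (\<Sum>a\<in>N u. card {e \<in> ?F. a \<in> e})" by simp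
  also have "\<dots> = (\<Sum>e\<in>?F. card {a \<in> N u. a \<in> e})"
    by (rule double_count) (simp_all add: finN finE)
  also have "\<dots> = (\<Sum>e\<in>?F. 2)"
  proof (rule sum.cong[OF refl])
    fix e assume e: "e \<in> ?F"
    then have "e \<in> E" by simp
    then obtain p q where pq: "p \<noteq> q" "e = {p, q}" by (elim edge_cases)
    have "{a \<in> N u. a \<in> e} = e" using e by auto
    then show "card {a \<in> N u. a \<in> e} = 2" using pq by simp
  qed
  finally show ?thesis by (simp add: inner_edges_def)
qed

text \<open>
  Among the second steps \<open>u, a, x\<close>, for each neighbor \<open>a\<close> one returns to
  \<open>u\<close>, which accounts for the neighbors of \<open>u\<close> themselves. The remaining
  ones reach the vertices at distance 2 or are wasted.
\<close>

lemma card_square_nbs: "card (N2 u) + defect u = (\<Sum>a\<in>N u. deg a)"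
proof -
  let ?M = "N2 u - N u"
  have part: "deg a = 1 + common u a + card {x \<in> ?M. x \<in> N a}" if a: "a \<in> N u" for a
  proof -
    have eq: "N a = insert u ((N u \<inter> N a) \<union> {x \<in> ?M. x \<in> N a})" (is "_ = insert u (?A \<union> ?B)")
    proof
      show "N a \<subseteq> insert u (?A \<union> ?B)"
      proof
        fix x assume x: "x \<in> N a"
        then have "a \<in> N x" using nbs_sym by fast
        then have "x = u \<or> x \<in> N2 u" using a by (auto simp: sq_def)
        then show "x \<in> insert u (?A \<union> ?B)" using x by auto
      qed
      show "insert u (?A \<union> ?B) \<subseteq> N a" using a nbs_sym by fast
    qed
    have nu: "u \<notin> ?A \<union> ?B" by (simp add: sq_def nbs_def)
    have fin: "finite ?A" "finite ?B" using finN finN2 by auto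
    have "?A \<inter> ?B = {}" by blast
    from card_Un_disjoint[OF fin this] card_insert_disjoint[OF finite_UnI[OF fin] nu]
    have "card (insert u (?A \<union> ?B)) = Suc (card ?A + card ?B)" by linarith
    then show ?thesis using arg_cong[OF eq, of card] by (simp add: common_def)
  qed
  have pos: "common u x \<ge> 1" if x: "x \<in> ?M" for x
  proof -
    have "N u \<inter> N x \<noteq> {}" using x by (auto simp: sq_def)
    then show ?thesis using finN by (simp add: common_def Suc_leI card_gt_0_iff)
  qed
  have "(\<Sum>a\<in>N u. deg a) = (\<Sum>a\<in>N u. 1 + common u a + card {x \<in> ?M. x \<in> N a})"
    using part by simp
  also have "\<dots> = card (N u) + 2 * inner_edges u + (\<Sum>a\<in>N u. card {x \<in> ?M. x \<in> N a})"
    by (simp only: sum.distrib sum_common_N) simp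
  also have "(\<Sum>a\<in>N u. card {x \<in> ?M. x \<in> N a}) = (\<Sum>x\<in>?M. card {a \<in> N u. x \<in> N a})"
    by (rule double_count) (simp_all add: finN finN2)
  also have "\<dots> = (\<Sum>x\<in>?M. 1 + (common u x - 1))"
  proof (rule sum.cong[OF refl])
    fix x assume x: "x \<in> ?M"
    have "{a \<in> N u. x \<in> N a} = N u \<inter> N x" using nbs_sym[of x E] by auto
    then have "card {a \<in> N u. x \<in> N a} = common u x" by (simp add: common_def)
    then show "card {a \<in> N u. x \<in> N a} = 1 + (common u x - 1)" using pos[OF x] by simp
  qed
  also have "\<dots> = card ?M + (\<Sum>x\<in>?M. common u x - 1)"
    by (simp only: sum.distrib card_eq_sum)
  finally have "(\<Sum>a\<in>N u. deg a) = card (N u) + card ?M + defect u" by (simp add: defect_def)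
  moreover have "card (N2 u) = card (N u) + card ?M"
  proof -
    have "N u \<subseteq> N2 u" by (auto simp: sq_def nbs_def)
    then show ?thesis using card_Diff_subset[OF finN, of u "N2 u"] card_mono[OF finN2, of "N u" u] by simp
  qed
  ultimately show ?thesis by simp
qed

lemma sum_deg_le: "(\<Sum>a\<in>N u. deg a) \<le> 4 * deg u"
  using sum_bounded_above[of "N u" deg 4] deg4 by (simp add: mult.commute)

lemma card_square_le: "card (N2 u) + defect u \<le> 4 * deg u"
  using card_square_nbs sum_deg_le by simp

lemma two_common_inner_edges:
  assumes "x \<in> N u" "common u x \<ge> 2"
  shows "inner_edges u \<ge> 2"
proof -
  have sub: "(\<lambda>w. {x, w}) ` (N u \<inter> N x) \<subseteq> {e \<in> E. e \<subseteq> N u}"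
    using assms(1) by (auto simp: nbs_def)
  have inj: "inj_on (\<lambda>w. {x, w}) (N u \<inter> N x)" by (auto simp: inj_on_def doubleton_eq_iff)
  have "finite {e \<in> E. e \<subseteq> N u}" using finE by simp
  from card_mono[OF this sub] have "card (N u \<inter> N x) \<le> inner_edges u"
    unfolding inner_edges_def card_image[OF inj] .
  then show ?thesis using assms(2) by (simp add: common_def)
qed

text \<open>
  The edge \<open>ux\<close> is the chord of a 4-cycle; its ends are called poles below.
\<close>

lemma pole_square_le:
  assumes "x \<in> N u" "common u x \<ge> 2"
  shows "card (N2 u) \<le> 12"
  using card_square_le[of u] two_common_inner_edges[OF assms] deg4[of u] by (simp add: defect_def)

end

section \<open>Reducible configurations\<close>

text \<open>
  A minimal counterexample for fixed lists, where minimality refers to the deletion of edges.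
\<close>

locale edge_critical = graph4 V E for V :: "'a set" and E :: "'a set set" +
  fixes L :: "'a \<Rightarrow> 'c set"
  assumes no5: "distinct [a, b, c, d, e] \<Longrightarrow>
      \<not> ({a, b} \<in> E \<and> {b, c} \<in> E \<and> {c, d} \<in> E \<and> {d, e} \<in> E \<and> {e, a} \<in> E)"
    and lists: "v \<in> V \<Longrightarrow> finite (L v) \<and> card (L v) = 12"
    and not_col: "\<not> square_colorable E L V"
    and crit: "D \<subseteq> E \<Longrightarrow> D \<noteq> {} \<Longrightarrow> square_colorable (E - D) L V"
begin

text \<open>
  Greedy coloring of \<open>X\<close>. The vertices of \<open>Y\<close> are to be colored later, so
  they impose no restriction yet.
\<close>

lemma extend_coloring:
  assumes "finite X" "square_colorable E L W" "(W \<union> X) \<inter> Y = {}"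
    and "\<And>x. x \<in> X \<Longrightarrow> x \<in> V \<and> card (N2 x - Y) \<le> 11"
  shows "square_colorable E L (W \<union> X)"
  using assms
proof (induction X rule: finite_induct)
  case empty
  then show ?case by simp
next
  case (insert x X)
  then have IH: "square_colorable E L (W \<union> X)" by auto
  show ?case
  proof (cases "x \<in> W \<union> X")
    case True
    then have "W \<union> insert x X = W \<union> X" by auto
    then show ?thesis using IH by simp
  next
    case False
    obtain c where c: "\<forall>v \<in> W \<union> X. c v \<in> L v"
      "\<forall>v \<in> W \<union> X. \<forall>w \<in> W \<union> X. w \<in> N2 v \<longrightarrow> c v \<noteq> c w"
      using IH unfolding square_colorable_def by blast
    let ?S = "N2 x \<inter> (W \<union> X)"
    have "?S \<subseteq> N2 x - Y" using insert.prems(2) by auto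
    then have "card ?S \<le> card (N2 x - Y)" using finN2 by (intro card_mono) auto
    moreover have "card (c ` ?S) \<le> card ?S" using finN2 by (intro card_image_le) auto
    ultimately have "card (c ` ?S) \<le> 11" using insert.prems(3)[of x] by simp
    moreover have "finite (c ` ?S)" using finN2 by auto
    moreover have "finite (L x)" "card (L x) = 12" using lists insert.prems(3)[of x] by auto
    ultimately have "\<not> L x \<subseteq> c ` ?S" using card_mono[of "c ` ?S" "L x"] by auto
    then obtain k where k: "k \<in> L x" "k \<notin> c ` ?S" by blast
    have x2: "x \<notin> N2 x" by (simp add: sq_def)
    show ?thesis
      unfolding square_colorable_def
    proof (intro exI[of _ "c(x := k)"] conjI ballI impI)
      fix v assume v: "v \<in> W \<union> insert x X"
      then show "(c(x := k)) v \<in> L v" using c(1) k(1) by auto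
      fix w assume w: "w \<in> W \<union> insert x X" "w \<in> N2 v"
      show "(c(x := k)) v \<noteq> (c(x := k)) w"
      proof (cases "v = x \<or> w = x")
        case True
        have "x \<in> N2 w" if "v = x" using w(2) that sq_sym by fast
        then show ?thesis using True v w k(2) x2 False sq_sym[of w E v] by auto
      next
        case False
        then show ?thesis using c(2) v w by auto
      qed
    qed
  qed
qed

lemma color_after_deletion:
  assumes "D \<subseteq> E" "D \<noteq> {}"
    and "\<And>x y. x \<in> V - U \<Longrightarrow> y \<in> V - U \<Longrightarrow> y \<in> N2 x \<Longrightarrow> y \<in> sq (E - D) x"
  shows "square_colorable E L (V - U)"
proof -
  obtain c where c: "\<forall>v \<in> V. c v \<in> L v" "\<forall>v \<in> V. \<forall>w \<in> V. w \<in> sq (E - D) v \<longrightarrow> c v \<noteq> c w"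
    using crit[OF assms(1,2)] unfolding square_colorable_def by blast
  then show ?thesis
    unfolding square_colorable_def using assms(3) by (intro exI[of _ c]) blast
qed

text \<open>
  Delete an edge inside \<open>U = {u} \<union> X \<union> Y\<close> and uncolor \<open>U\<close>. A
  pair of adjacent vertices of the square which loses its adjacency must use the deleted edge and
  hence meets \<open>U\<close>, so the rest is still properly colored. Then \<open>u\<close>,
  \<open>X\<close> and \<open>Y\<close> can be recolored in this order.
\<close>

lemma reducible_stages:
  assumes e: "e \<in> E" "e \<subseteq> insert u (X \<union> Y)" and sub: "insert u (X \<union> Y) \<subseteq> V"
    and dis: "u \<notin> X \<union> Y" "X \<inter> Y = {}"
    and u: "card (N2 u - (X \<union> Y)) \<le> 11"
    and X: "\<And>x. x \<in> X \<Longrightarrow> card (N2 x - Y) \<le> 11"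
    and Y: "\<And>y. y \<in> Y \<Longrightarrow> card (N2 y) \<le> 11"
  shows False
proof -
  let ?U = "insert u (X \<union> Y)"
  have keep: "w \<in> nbs (E - {e}) v" if "w \<in> N v" "v \<notin> ?U \<or> w \<notin> ?U" for v w
    using that e(2) by (auto simp: nbs_def)
  have 0: "square_colorable E L (V - ?U)"
  proof (rule color_after_deletion[of "{e}"])
    fix x y assume xy: "x \<in> V - ?U" "y \<in> V - ?U" "y \<in> N2 x"
    show "y \<in> sq (E - {e}) x"
    proof (cases "y \<in> N x")
      case True
      then show ?thesis using keep[of y x] xy by (auto simp: sq_def)
    next
      case False
      then obtain z where z: "z \<in> N x" "z \<in> N y" "y \<noteq> x" using xy(3) by (auto simp: sq_def)
      then have "z \<in> nbs (E - {e}) x" "z \<in> nbs (E - {e}) y" using keep xy by auto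
      then show ?thesis using z(3) by (auto simp: sq_def)
    qed
  qed (use e in auto)
  have fin: "finite X" "finite Y" using sub finV finite_subset by auto
  have 1: "square_colorable E L ((V - ?U) \<union> {u})"
    by (rule extend_coloring[where Y = "X \<union> Y"]) (use 0 sub dis u in auto)
  have 2: "square_colorable E L (((V - ?U) \<union> {u}) \<union> X)"
    by (rule extend_coloring[where Y = Y]) (use 1 fin sub dis X in auto)
  have "square_colorable E L ((((V - ?U) \<union> {u}) \<union> X) \<union> Y)"
    by (rule extend_coloring[where Y = "{}"]) (use 2 fin sub dis Y in auto)
  moreover have "(((V - ?U) \<union> {u}) \<union> X) \<union> Y = V" using sub by auto
  ultimately show False using not_col by simp
qed

lemma light_edge:
  assumes "v \<in> N u" "card (N2 u) \<le> 11" "card (N2 v) \<le> 12"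
  shows False
proof (rule reducible_stages[of "{u, v}" v "{}" "{u}"])
  show "{u, v} \<in> E" using assms(1) by (rule N_edge)
  show "insert v ({} \<union> {u}) \<subseteq> V" using assms(1) N_V nbs_sym by fast
  have "u \<in> N2 v" using assms(1) nbs_sym[of v E u] by (auto simp: sq_def nbs_def)
  then have "card (N2 v - {u}) = card (N2 v) - 1" by simp
  then show "card (N2 v - ({} \<union> {u})) \<le> 11" using assms(3) by simp
qed (use assms in \<open>auto simp: nbs_def\<close>)

text \<open>
  If the neighbors of \<open>v\<close> are pairwise adjacent, then deleting all edges at
  \<open>v\<close> does not change the square outside \<open>v\<close>, and only \<open>v\<close>
  has to be recolored. This excludes leaves and vertices of degree 2 in a triangle.
\<close>

lemma reducible_simplicial:
  assumes "N v \<noteq> {}" "\<And>a b. a \<in> N v \<Longrightarrow> b \<in> N v \<Longrightarrow> a \<noteq> b \<Longrightarrow> {a, b} \<in> E" "card (N2 v) \<le> 11"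
  shows False
proof -
  let ?D = "{e \<in> E. v \<in> e}"
  have keep: "w \<in> nbs (E - ?D) x" if "w \<in> N x" "x \<noteq> v" "w \<noteq> v" for w x
    using that by (auto simp: nbs_def)
  have vV: "v \<in> V" using assms(1) N_V nbs_sym by fast
  have 0: "square_colorable E L (V - {v})"
  proof (rule color_after_deletion[of ?D])
    show "?D \<noteq> {}" using assms(1) by (auto simp: nbs_def)
    fix x y assume xy: "x \<in> V - {v}" "y \<in> V - {v}" "y \<in> N2 x"
    then have yx: "y \<noteq> x" by (simp add: sq_def)
    show "y \<in> sq (E - ?D) x"
    proof (cases "y \<in> N x \<or> v \<in> N x \<inter> N y")
      case True
      have "y \<in> N x"
      proof (cases "y \<in> N x")
        case False
        then have "x \<in> N v" "y \<in> N v" using True nbs_sym by fast+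
        then have "{x, y} \<in> E" using assms(2) yx by auto
        then show ?thesis using yx by (simp add: nbs_def)
      qed
      then show ?thesis using keep[of y x] xy yx by (simp add: sq_def)
    next
      case False
      then obtain z where z: "z \<in> N x" "z \<in> N y" "z \<noteq> v" using xy(3) by (auto simp: sq_def)
      then have "z \<in> nbs (E - ?D) x" "z \<in> nbs (E - ?D) y" using keep xy by auto
      then show ?thesis using yx by (auto simp: sq_def)
    qed
  qed auto
  have "square_colorable E L ((V - {v}) \<union> {v})"
    by (rule extend_coloring[where Y = "{}"]) (use 0 vV assms(3) in auto)
  moreover have "(V - {v}) \<union> {v} = V" using vV by auto
  ultimately show False using not_col by simp
qed

text \<open>
  Both poles have at most 12 neighbors in the square, so neither has fewer: otherwise the edge
  between them would be light. Then a further triangle at \<open>u\<close>, or a 4-cycle whose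
  vertex opposite to \<open>u\<close> is at distance 2, would raise the defect above 4.
\<close>

lemma pole_defect:
  assumes "x \<in> N u" "common u x \<ge> 2"
  shows "inner_edges u = 2" "\<And>y. y \<in> N2 u - N u \<Longrightarrow> common u y \<le> 1"
proof -
  have "u \<in> N x" "common x u \<ge> 2" using assms nbs_sym by (fast, simp add: common_def Int_commute)
  then have "card (N2 x) \<le> 12" by (rule pole_square_le)
  then have "card (N2 u) \<ge> 12" using light_edge[OF assms(1)] by fastforce
  then have "defect u \<le> 4" using card_square_le[of u] deg4[of u] by simp
  then have d: "2 * inner_edges u + (\<Sum>x \<in> N2 u - N u. common u x - 1) \<le> 4" by (simp add: defect_def)
  then show i: "inner_edges u = 2" using two_common_inner_edges[OF assms] by simp
  then have "(\<Sum>x \<in> N2 u - N u. common u x - 1) = 0" using d by simp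
  then have "\<forall>x \<in> N2 u - N u. common u x - 1 = 0"
    using finN2[of u] by (subst (asm) sum_eq_0_iff) auto
  then show "common u y \<le> 1" if "y \<in> N2 u - N u" for y using that by auto
qed

end

section \<open>Short even edge sets\<close>

lemma even_edges_diff:
  assumes "finite Z" "C \<subseteq> Z" "even_edges Z" "even_edges C"
  shows "even_edges (Z - C)"
  unfolding even_edges_def
proof
  fix v
  have "{e \<in> Z - C. v \<in> e} = {e \<in> Z. v \<in> e} - {e \<in> C. v \<in> e}" by auto
  moreover have "card ({e \<in> Z. v \<in> e} - {e \<in> C. v \<in> e}) = card {e \<in> Z. v \<in> e} - card {e \<in> C. v \<in> e}"
    by (rule card_Diff_subset) (use finite_subset[OF assms(2,1)] assms(2) in auto)
  ultimately show "even (card {e \<in> Z - C. v \<in> e})" using assms(3,4) by (simp add: even_edges_def)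
qed

definition tri :: "'a \<Rightarrow> 'a \<Rightarrow> 'a \<Rightarrow> 'a set set" where
  "tri a b c = {{a, b}, {b, c}, {a, c}}"

definition quad :: "'a \<Rightarrow> 'a \<Rightarrow> 'a \<Rightarrow> 'a \<Rightarrow> 'a set set" where
  "quad a b c d = {{a, b}, {b, c}, {c, d}, {a, d}}"

lemma tri_rotate: "tri a b c = tri b c a"
  by (auto simp: tri_def insert_commute)

lemma quad_rotate: "quad a b c d = quad b c d a"
  by (auto simp: quad_def insert_commute)

lemma tri_flip: "tri a b c = tri a c b"
  by (auto simp: tri_def insert_commute)

lemma quad_flip: "quad a b c d = quad a d c b"
  by (auto simp: quad_def insert_commute)

lemma card_tri: "distinct [a, b, c] \<Longrightarrow> card (tri a b c) = 3"
  by (auto simp: tri_def doubleton_eq_iff card_insert_if)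

lemma card_quad: "distinct [a, b, c, d] \<Longrightarrow> card (quad a b c d) = 4"
  by (auto simp: quad_def doubleton_eq_iff card_insert_if)

lemma Union_tri: "\<Union>(tri a b c) = {a, b, c}"
  by (auto simp: tri_def)

lemma Union_quad: "\<Union>(quad a b c d) = {a, b, c, d}"
  by (auto simp: quad_def)

lemma edges_of_tri: "distinct [v, a, b] \<Longrightarrow> {e \<in> tri v a b. v \<in> e} = {{v, a}, {v, b}}"
  by (auto simp: tri_def)

lemma edges_of_quad: "distinct [v, a, x, b] \<Longrightarrow> {e \<in> quad v a x b. v \<in> e} = {{v, a}, {v, b}}"
  by (auto simp: quad_def)

lemma even_tri:
  fixes a b c :: 'a
  assumes d: "distinct [a, b, c]"
  shows "even_edges (tri a b c)"
  unfolding even_edges_def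
proof
  fix v :: 'a
  have *: "even (card {e \<in> tri v x y. v \<in> e})" if "distinct [v, x, y]" for x y
    using edges_of_tri[OF that] that by (simp add: doubleton_eq_iff card_insert_if)
  consider "v = a" | "v = b" | "v = c" | "v \<notin> {a, b, c}" by blast
  then show "even (card {e \<in> tri a b c. v \<in> e})"
  proof cases
    case 1
    then show ?thesis using * d by simp
  next
    case 2
    have "tri a b c = tri b c a" by (rule tri_rotate)
    then show ?thesis using *[of c a] d 2 by auto
  next
    case 3
    have "tri a b c = tri c a b" using tri_rotate[of a b c] tri_rotate[of b c a] by simp
    then show ?thesis using *[of a b] d 3 by auto
  next
    case 4
    then have "{e \<in> tri a b c. v \<in> e} = {}" by (auto simp: tri_def)
    then show ?thesis by (simp only: card.empty dvd_0_right)
  qed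
qed

lemma even_quad:
  fixes a b c d :: 'a
  assumes d: "distinct [a, b, c, d]"
  shows "even_edges (quad a b c d)"
  unfolding even_edges_def
proof
  fix v :: 'a
  have *: "even (card {e \<in> quad v x y z. v \<in> e})" if "distinct [v, x, y, z]" for x y z
    using edges_of_quad[OF that] that by (simp add: doubleton_eq_iff card_insert_if)
  consider "v = a" | "v = b" | "v = c" | "v = d" | "v \<notin> {a, b, c, d}" by blast
  then show "even (card {e \<in> quad a b c d. v \<in> e})"
  proof cases
    case 1
    then show ?thesis using * d by simp
  next
    case 2
    have "quad a b c d = quad b c d a" by (rule quad_rotate)
    then show ?thesis using *[of c d a] d 2 by auto
  next
    case 3
    have "quad a b c d = quad c d a b" using quad_rotate[of a b c d] quad_rotate[of b c d a] by simp
    then show ?thesis using *[of d a b] d 3 by auto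
  next
    case 4
    have "quad a b c d = quad d a b c"
      using quad_rotate[of a b c d] quad_rotate[of b c d a] quad_rotate[of c d a b] by simp
    then show ?thesis using *[of a b c] d 4 by auto
  next
    case 5
    then have "{e \<in> quad a b c d. v \<in> e} = {}" by (auto simp: quad_def)
    then show ?thesis by (simp only: card.empty dvd_0_right)
  qed
qed

lemma card_filter_3:
  assumes "a \<noteq> b" "a \<noteq> c" "b \<noteq> c"
  shows "card {z \<in> {a, b, c}. P z} = of_bool (P a) + of_bool (P b) + of_bool (P c)"
proof -
  have "{z \<in> {a, b, c}. P z} =
      (if P a then {a} else {}) \<union> (if P b then {b} else {}) \<union> (if P c then {c} else {})" by auto
  then show ?thesis using assms by simp
qed

lemma triples_sharing_one:
  "distinct [e1, e2, e3, e4, e5] \<Longrightarrow>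
    g \<in> {e3, e2, e4, e5} \<longleftrightarrow> (g \<in> {e1, e2, e3}) \<noteq> (g \<in> {e1, e4, e5})"
  by auto

text \<open>
  A 4-cycle with a chord is the sum modulo 2 of the two triangles at the chord.
\<close>

lemma quad_sum_tri:
  assumes "distinct [u, a, x, c]"
  shows "g \<in> quad u a x c \<longleftrightarrow> (g \<in> tri u x a) \<noteq> (g \<in> tri u x c)"
proof -
  have "distinct [{u, x}, {x, a}, {u, a}, {x, c}, {u, c}]"
    using assms by (auto simp: doubleton_eq_iff)
  moreover have "quad u a x c = {{u, a}, {x, a}, {x, c}, {u, c}}"
    by (simp add: quad_def insert_commute)
  ultimately show ?thesis using triples_sharing_one by (simp only: tri_def)
qed

lemma other_element:
  assumes "S \<noteq> {x}" "x \<in> S"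
  obtains y where "y \<in> S" "y \<noteq> x"
  using assms by blast

context graph4
begin

lemma even_next:
  assumes "even_edges Z" "Z \<subseteq> E" "{a, b} \<in> Z"
  obtains c where "c \<noteq> a" "c \<noteq> b" "{b, c} \<in> Z"
proof -
  let ?S = "{e \<in> Z. b \<in> e}"
  have "even (card ?S)" using assms(1) by (simp add: even_edges_def)
  then have "card ?S \<noteq> card {{a, b}}" by auto
  then have "?S \<noteq> {{a, b}}" by (rule contrapos_nn) (rule arg_cong)
  moreover have "{a, b} \<in> ?S" using assms(3) by simp
  ultimately obtain e where "e \<in> ?S" "e \<noteq> {a, b}" by (rule other_element)
  then have e: "e \<in> Z" "b \<in> e" "e \<noteq> {a, b}" by simp_all
  then obtain c where c: "c \<in> N b" "e = {b, c}" using edge_at[of e b] assms(2) by blast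
  have "c \<noteq> a" using c e(3) by (auto simp: insert_commute)
  moreover have "c \<noteq> b" using c(1) by (simp add: nbs_def)
  ultimately show ?thesis using that[of c] e(1) c(2) by simp
qed

lemma even_card_ge_3:
  assumes "even_edges Z" "Z \<subseteq> E" "Z \<noteq> {}"
  shows "card Z \<ge> 3"
proof -
  obtain e where e: "e \<in> Z" using assms(3) by auto
  then have "e \<in> E" using assms(2) by auto
  then obtain a b where ab: "a \<noteq> b" "e = {a, b}" by (rule edge_cases)
  have 1: "{a, b} \<in> Z" using e ab(2) by simp
  obtain c where c: "c \<noteq> a" "c \<noteq> b" "{b, c} \<in> Z" using even_next[OF assms(1,2) 1] .
  obtain d where d: "d \<noteq> b" "d \<noteq> c" "{c, d} \<in> Z" using even_next[OF assms(1,2) c(3)] .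
  have "card {{a, b}, {b, c}, {c, d}} = 3" using ab c d by (auto simp: doubleton_eq_iff card_insert_if)
  moreover have "card {{a, b}, {b, c}, {c, d}} \<le> card Z"
    using 1 c d finite_subset[OF assms(2) finE] by (intro card_mono) auto
  ultimately show ?thesis by simp
qed

lemma even_eq_subset:
  assumes "even_edges Z" "Z \<subseteq> E" "card Z \<le> 5" "even_edges C" "C \<subseteq> Z" "card C \<ge> 3"
  shows "Z = C"
proof -
  have fin: "finite Z" using finite_subset[OF assms(2) finE] .
  have "card (Z - C) = card Z - card C" using fin assms(5) finite_subset by (intro card_Diff_subset) auto
  then have "card (Z - C) < 3" using assms(3,6) by simp
  then have "Z - C = {}" using even_card_ge_3[OF even_edges_diff[OF fin assms(5,1,4)]] assms(2) by fastforce
  then show ?thesis using assms(5) by auto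
qed

text \<open>
  Follow edges from an arbitrary edge until the walk closes up. Once a triangle or 4-cycle appears,
  it is the whole set, since what is left is even and has fewer than 3 edges.
\<close>

lemma even_small_cases:
  assumes Z: "even_edges Z" "Z \<subseteq> E" "Z \<noteq> {}" "card Z \<le> 5"
  obtains (tri) a b c where "distinct [a, b, c]" "Z = tri a b c"
  | (quad) a b c d where "distinct [a, b, c, d]" "Z = quad a b c d"
  | (pent) a b c d e where "distinct [a, b, c, d, e]" "{a, b} \<in> E" "{b, c} \<in> E" "{c, d} \<in> E" "{d, e} \<in> E" "{e, a} \<in> E"
proof -
  have fin: "finite Z" using finite_subset[OF Z(2) finE] .
  have T: thesis if t: "distinct [a, b, c]" "{a, b} \<in> Z" "{b, c} \<in> Z" "{a, c} \<in> Z" for a b c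
    by (rule tri[OF t(1)], rule even_eq_subset[OF Z(1,2,4) even_tri[OF t(1)]])
      (use t card_tri[OF t(1)] in \<open>auto simp: tri_def\<close>)
  have Q: thesis if q: "distinct [a, b, c, d]" "{a, b} \<in> Z" "{b, c} \<in> Z" "{c, d} \<in> Z" "{a, d} \<in> Z" for a b c d
    by (rule quad[OF q(1)], rule even_eq_subset[OF Z(1,2,4) even_quad[OF q(1)]])
      (use q card_quad[OF q(1)] in \<open>auto simp: quad_def\<close>)
  obtain e0 where e0: "e0 \<in> Z" using Z(3) by auto
  then have "e0 \<in> E" using Z(2) by auto
  then obtain a b where ab: "a \<noteq> b" "e0 = {a, b}" by (rule edge_cases)
  have 1: "{a, b} \<in> Z" using e0 ab(2) by simp
  obtain c where c: "c \<noteq> a" "c \<noteq> b" "{b, c} \<in> Z" using even_next[OF Z(1,2) 1] .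
  obtain d where d: "d \<noteq> b" "d \<noteq> c" "{c, d} \<in> Z" using even_next[OF Z(1,2) c(3)] .
  obtain e where e: "e \<noteq> c" "e \<noteq> d" "{d, e} \<in> Z" using even_next[OF Z(1,2) d(3)] .
  have "{b, a} \<in> Z" using 1 by (simp add: insert_commute)
  then obtain f where f: "f \<noteq> b" "f \<noteq> a" "{a, f} \<in> Z" by (rule even_next[OF Z(1,2)])
  obtain g where g: "g \<noteq> d" "g \<noteq> e" "{e, g} \<in> Z" using even_next[OF Z(1,2) e(3)] .
  consider "d = a" | "d \<noteq> a" "e = a" | "d \<noteq> a" "e = b" | "d \<noteq> a" "e \<noteq> a" "e \<noteq> b" by blast
  then show thesis
  proof cases
    case 1
    then show thesis using T[of a b c] ab c d \<open>{a, b} \<in> Z\<close> by (simp add: insert_commute)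
  next
    case 2
    then show thesis using Q[of a b c d] ab c d e \<open>{a, b} \<in> Z\<close> by (simp add: insert_commute)
  next
    case 3
    then show thesis using T[of b c d] ab c d e by (simp add: insert_commute)
  next
    case 4
    consider "f = c" | "f = d" | "f = e" | "f \<notin> {c, d, e}" by blast
    then show thesis
    proof cases
      case 1
      then show thesis using T[of a b c] ab c f \<open>{a, b} \<in> Z\<close> by simp
    next
      case 2
      then show thesis using Q[of a b c d] ab c d f 4 \<open>{a, b} \<in> Z\<close> by simp
    next
      case 3
      have "{a, b} \<in> E" "{b, c} \<in> E" "{c, d} \<in> E" "{d, e} \<in> E" "{e, a} \<in> E"
        using Z(2) \<open>{a, b} \<in> Z\<close> c d e f 3 by (auto simp: insert_commute)
      then show thesis using pent[of a b c d e] ab c d e 4 by simp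
    next
      case new: 4
      let ?P = "{{a, b}, {b, c}, {c, d}, {d, e}, {a, f}, {e, g}}"
      have "card ?P = 6"
        using ab c d e f g 4 new by (simp add: doubleton_eq_iff card_insert_if)
      moreover have "card ?P \<le> card Z"
        using \<open>{a, b} \<in> Z\<close> c d e f g fin by (intro card_mono) auto
      ultimately show thesis using Z(4) by simp
    qed
  qed
qed

end

section \<open>Triangles and 4-cycles of the basis\<close>

text \<open>
  A minimal counterexample together with a family as provided by planarity. The vertices without
  edges are left out of the count, as deletion of edges produces them without control.
\<close>

locale critical_basis = edge_critical V E L
  for V :: "'a set" and E :: "'a set set" and L :: "'a \<Rightarrow> 'c set" +
  fixes B :: "'a set set set"
  assumes finB: "finite B"
    and B_sub: "Z \<in> B \<Longrightarrow> Z \<subseteq> E"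
    and B_even: "Z \<in> B \<Longrightarrow> even_edges Z"
    and B_two: "g \<in> E \<Longrightarrow> card {Z \<in> B. g \<in> Z} \<le> 2"
    and B_indep: "S \<subseteq> B \<Longrightarrow> S \<noteq> {} \<Longrightarrow> \<exists>g. card {Z \<in> S. g \<in> Z} = 1"
    and B_euler: "card E + 1 \<le> card B + card {v \<in> V. N v \<noteq> {}}"
begin

lemma B_indepE:
  assumes "S \<subseteq> B" "S \<noteq> {}"
  obtains g Z where "Z \<in> S" "g \<in> Z" "card {Z \<in> S. g \<in> Z} = 1"
proof -
  obtain g where g: "card {Z \<in> S. g \<in> Z} = 1" using B_indep[OF assms] by blast
  then obtain Z where "{Z \<in> S. g \<in> Z} = {Z}" by (rule card_1_singletonE)
  then have "Z \<in> {Z \<in> S. g \<in> Z}" by (simp only: insertI1)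
  then show ?thesis using that g by blast
qed

lemma B_nonempty: "Z \<in> B \<Longrightarrow> Z \<noteq> {}"
  using B_indepE[of "{Z}"] by auto

lemma B_cases:
  assumes "Z \<in> B"
  obtains (tri) a b c where "distinct [a, b, c]" "Z = tri a b c"
  | (quad) a b c d where "distinct [a, b, c, d]" "Z = quad a b c d"
  | (big) "card Z \<ge> 6"
proof (cases "card Z \<le> 5")
  case True
  show ?thesis
  proof (rule even_small_cases[OF B_even[OF assms] B_sub[OF assms] B_nonempty[OF assms] True])
    show thesis if "distinct [a, b, c, d, e]" "{a, b} \<in> E" "{b, c} \<in> E" "{c, d} \<in> E" "{d, e} \<in> E" "{e, a} \<in> E"
      for a b c d e using no5[OF that(1)] that(2-) by blast
  qed (use tri quad in blast)+
next
  case False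
  then show ?thesis using big by simp
qed

lemma card_B_cases: "Z \<in> B \<Longrightarrow> card Z = 3 \<or> card Z = 4 \<or> card Z \<ge> 6"
  by (erule B_cases) (auto simp: card_tri card_quad)

lemma B_triE:
  assumes "Z \<in> B" "card Z = 3"
  obtains a b c where "distinct [a, b, c]" "Z = tri a b c"
  using assms(2) by (cases rule: B_cases[OF assms(1)]) (auto simp: card_quad intro: that)

lemma B_quadE:
  assumes "Z \<in> B" "card Z = 4"
  obtains a b c d where "distinct [a, b, c, d]" "Z = quad a b c d"
  using assms(2) by (cases rule: B_cases[OF assms(1)]) (auto simp: card_tri intro: that)

definition cycles_at :: "nat \<Rightarrow> 'a \<Rightarrow> 'a set set set" where
  "cycles_at k v = {Z \<in> B. card Z = k \<and> v \<in> \<Union>Z}"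

abbreviation tri_count :: "'a \<Rightarrow> nat" where "tri_count v \<equiv> card (cycles_at 3 v)"
abbreviation quad_count :: "'a \<Rightarrow> nat" where "quad_count v \<equiv> card (cycles_at 4 v)"

lemma fin_cycles_at: "finite (cycles_at k v)"
  using finB by (simp add: cycles_at_def)

lemma cycles_at_B: "Z \<in> cycles_at k v \<Longrightarrow> Z \<in> B"
  by (simp add: cycles_at_def)

lemma tri_at:
  assumes "Z \<in> cycles_at 3 v"
  obtains a b where "distinct [v, a, b]" "Z = tri v a b" "a \<in> N v" "b \<in> N v" "b \<in> N a"
proof -
  have Z: "Z \<in> B" "card Z = 3" "v \<in> \<Union>Z" using assms by (auto simp: cycles_at_def)
  obtain x y z where xyz: "distinct [x, y, z]" "Z = tri x y z" using B_triE[OF Z(1,2)] .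
  have "v = x \<or> v = y \<or> v = z" using Z(3) xyz(2) Union_tri by fast
  then have "\<exists>a b. distinct [v, a, b] \<and> Z = tri v a b"
  proof (elim disjE)
    assume "v = x"
    then show ?thesis using xyz by blast
  next
    assume "v = y"
    then show ?thesis using xyz tri_rotate[of x y z] by (intro exI[of _ z] exI[of _ x]) auto
  next
    assume "v = z"
    then show ?thesis using xyz tri_rotate[of x y z] tri_rotate[of y z x]
      by (intro exI[of _ x] exI[of _ y]) auto
  qed
  then obtain a b where ab: "distinct [v, a, b]" "Z = tri v a b" by blast
  then have "{v, a} \<in> E" "{v, b} \<in> E" "{a, b} \<in> E" using B_sub[OF Z(1)] by (auto simp: tri_def)
  then show ?thesis using that[OF ab] ab(1) edge_N by auto
qed

lemma quad_at:
  assumes "Z \<in> cycles_at 4 v"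
  obtains a x b where "distinct [v, a, x, b]" "Z = quad v a x b" "a \<in> N v" "b \<in> N v" "a \<in> N x" "b \<in> N x"
proof -
  have Z: "Z \<in> B" "card Z = 4" "v \<in> \<Union>Z" using assms by (auto simp: cycles_at_def)
  obtain w x y z where xyz: "distinct [w, x, y, z]" "Z = quad w x y z" using B_quadE[OF Z(1,2)] .
  have "v = w \<or> v = x \<or> v = y \<or> v = z" using Z(3) xyz(2) Union_quad by fast
  then have "\<exists>a x b. distinct [v, a, x, b] \<and> Z = quad v a x b"
  proof (elim disjE)
    assume "v = w"
    then show ?thesis using xyz by blast
  next
    assume "v = x"
    then show ?thesis using xyz quad_rotate[of w x y z]
      by (intro exI[of _ y] exI[of _ z] exI[of _ w]) auto
  next
    assume "v = y"
    then show ?thesis using xyz quad_rotate[of w x y z] quad_rotate[of x y z w]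
      by (intro exI[of _ z] exI[of _ w] exI[of _ x]) auto
  next
    assume "v = z"
    then show ?thesis
      using xyz quad_rotate[of w x y z] quad_rotate[of x y z w] quad_rotate[of y z w x]
      by (intro exI[of _ w] exI[of _ x] exI[of _ y]) auto
  qed
  then obtain a c b where ab: "distinct [v, a, c, b]" "Z = quad v a c b" by blast
  then have "{v, a} \<in> E" "{v, b} \<in> E" "{c, a} \<in> E" "{c, b} \<in> E"
    using B_sub[OF Z(1)] by (auto simp: quad_def insert_commute)
  then show ?thesis using that[OF ab] ab(1) edge_N by auto
qed

lemma two_edges_at:
  assumes "Z \<in> cycles_at 3 v \<union> cycles_at 4 v"
  shows "card {w \<in> N v. {v, w} \<in> Z} = 2"
proof -
  have "\<exists>a b. a \<noteq> b \<and> {w \<in> N v. {v, w} \<in> Z} = {a, b}"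
  proof (cases "Z \<in> cycles_at 3 v")
    case True
    then obtain a b where ab: "distinct [v, a, b]" "Z = tri v a b" "a \<in> N v" "b \<in> N v" by (elim tri_at)
    have "{w \<in> N v. {v, w} \<in> Z} = {a, b}"
      using ab by (auto simp: tri_def doubleton_eq_iff)
    then show ?thesis using ab(1) by auto
  next
    case False
    then have "Z \<in> cycles_at 4 v" using assms by blast
    then obtain a x b where ab: "distinct [v, a, x, b]" "Z = quad v a x b" "a \<in> N v" "b \<in> N v" by (elim quad_at)
    have "{w \<in> N v. {v, w} \<in> Z} = {a, b}"
      using ab by (auto simp: quad_def doubleton_eq_iff)
    then show ?thesis using ab(1) by auto
  qed
  then obtain a b where "a \<noteq> b" "{w \<in> N v. {v, w} \<in> Z} = {a, b}" by blast
  then show ?thesis by simp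
qed

lemma incidences_at:
  assumes "A \<subseteq> cycles_at 3 v \<union> cycles_at 4 v"
  shows "(\<Sum>w\<in>N v. card {Z \<in> A. {v, w} \<in> Z}) = 2 * card A"
proof -
  have fin: "finite A" using finite_subset[OF assms] fin_cycles_at by simp
  have "(\<Sum>w\<in>N v. card {Z \<in> A. {v, w} \<in> Z}) = (\<Sum>Z\<in>A. card {w \<in> N v. {v, w} \<in> Z})"
    by (rule double_count[OF finN fin])
  also have "\<dots> = (\<Sum>Z\<in>A. 2)" using two_edges_at assms by (intro sum.cong) auto
  finally show ?thesis by simp
qed

lemma card_through_le_2: "A \<subseteq> B \<Longrightarrow> w \<in> N v \<Longrightarrow> card {Z \<in> A. {v, w} \<in> Z} \<le> 2"
proof -
  assume A: "A \<subseteq> B" "w \<in> N v"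
  have "card {Z \<in> A. {v, w} \<in> Z} \<le> card {Z \<in> B. {v, w} \<in> Z}"
    using A(1) finB by (intro card_mono) auto
  then show ?thesis using B_two[OF N_edge[OF A(2)]] by simp
qed

lemma tri_quad_count_le_deg: "tri_count v + quad_count v \<le> deg v"
proof -
  let ?A = "cycles_at 3 v \<union> cycles_at 4 v"
  have "2 * card ?A = (\<Sum>w\<in>N v. card {Z \<in> ?A. {v, w} \<in> Z})" using incidences_at[of ?A v] by simp
  also have "\<dots> \<le> (\<Sum>w\<in>N v. 2)"
    by (intro sum_mono card_through_le_2) (auto simp: cycles_at_def)
  finally have "card ?A \<le> deg v" by simp
  moreover have "card ?A = tri_count v + quad_count v"
    by (intro card_Un_disjoint fin_cycles_at) (auto simp: cycles_at_def)
  ultimately show ?thesis by simp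
qed

lemma tri_count_le: "tri_count v \<le> inner_edges v"
proof -
  have "inj_on (\<lambda>Z. \<Union>Z - {v}) (cycles_at 3 v)"
  proof (rule inj_onI)
    fix Z Z' assume Z: "Z \<in> cycles_at 3 v" "Z' \<in> cycles_at 3 v" "\<Union>Z - {v} = \<Union>Z' - {v}"
    obtain a b where ab: "distinct [v, a, b]" "Z = tri v a b" using tri_at[OF Z(1)] by metis
    obtain a' b' where ab': "distinct [v, a', b']" "Z' = tri v a' b'" using tri_at[OF Z(2)] by metis
    have "{a, b} = {a', b'}" using Z(3) ab ab' by (auto simp: Union_tri)
    then have "a = a' \<and> b = b' \<or> a = b' \<and> b = a'" by (simp add: doubleton_eq_iff)
    then show "Z = Z'" using ab(2) ab'(2) tri_flip[of v a b] by (elim disjE conjE) simp_all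
  qed
  moreover have "(\<lambda>Z. \<Union>Z - {v}) ` cycles_at 3 v \<subseteq> {e \<in> E. e \<subseteq> N v}"
  proof
    fix e assume "e \<in> (\<lambda>Z. \<Union>Z - {v}) ` cycles_at 3 v"
    then obtain Z where Z: "Z \<in> cycles_at 3 v" "e = \<Union>Z - {v}" by blast
    obtain a b where ab: "distinct [v, a, b]" "Z = tri v a b" "a \<in> N v" "b \<in> N v" "b \<in> N a"
      using tri_at[OF Z(1)] .
    have "e = {a, b}" using Z(2) ab(1,2) by (auto simp: Union_tri)
    then show "e \<in> {e \<in> E. e \<subseteq> N v}" using ab N_edge by simp
  qed
  ultimately show ?thesis
    unfolding inner_edges_def using card_inj_on_le[of _ "cycles_at 3 v" "{e \<in> E. e \<subseteq> N v}"] finE by simp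
qed

text \<open>
  The 4-cycles of the basis that pass through \<open>v\<close> and have \<open>x\<close> as the
  vertex opposite to it.
\<close>

definition quads_via :: "'a \<Rightarrow> 'a \<Rightarrow> 'a set set set" where
  "quads_via v x = {Z \<in> cycles_at 4 v. \<exists>a b. distinct [v, a, x, b] \<and> Z = quad v a x b}"

lemma quads_via_common:
  assumes "Z \<in> quads_via v x"
  obtains a b where "distinct [v, a, x, b]" "Z = quad v a x b" "a \<in> N v \<inter> N x" "b \<in> N v \<inter> N x"
proof -
  obtain a b where ab: "distinct [v, a, x, b]" "Z = quad v a x b" and Z: "Z \<in> B"
    using assms by (auto simp: quads_via_def cycles_at_def)
  then have "{v, a} \<in> E" "{v, b} \<in> E" "{x, a} \<in> E" "{x, b} \<in> E"
    using B_sub[OF Z] by (auto simp: quad_def insert_commute)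
  then show ?thesis using that[OF ab] ab(1) edge_N by auto
qed

text \<open>
  View the common neighbors of \<open>v\<close> and \<open>x\<close> as the vertices of a graph, and
  the 4-cycles as its edges. All degrees in it are at most 2. If it had as many edges as vertices,
  all of them would be exactly 2, so every edge of these 4-cycles would lie in exactly two of them,
  against independence.
\<close>

lemma card_quads_via: "card (quads_via v x) \<le> common v x - 1"
proof (rule ccontr)
  let ?P = "quads_via v x"
  let ?M = "N v \<inter> N x"
  assume n: "\<not> card ?P \<le> common v x - 1"
  have sub: "?P \<subseteq> cycles_at 4 v" "?P \<subseteq> B" by (auto simp: quads_via_def cycles_at_def)
  have "?P \<noteq> {}" using n by auto
  then obtain Z0 where "Z0 \<in> ?P" by blast
  then obtain a0 where "a0 \<in> ?M" by (elim quads_via_common)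
  then have "?M \<noteq> {}" "finite ?M" using finN by auto
  then have "common v x > 0" by (simp add: common_def card_gt_0_iff)
  then have big: "card ?P \<ge> common v x" using n by simp
  have le2: "card {Z \<in> ?P. {v, a} \<in> Z} \<le> 2" if "a \<in> N v" for a
    by (rule card_through_le_2) (use sub that in auto)
  \<comment> \<open>the 4-cycles pass through common neighbors only\<close>
  have out: "card {Z \<in> ?P. {v, a} \<in> Z} = 0" if a: "a \<in> N v - ?M" for a
  proof -
    have "{v, a} \<notin> Z" if Z: "Z \<in> ?P" for Z
    proof -
      obtain c d where cd: "distinct [v, c, x, d]" "Z = quad v c x d" "c \<in> ?M" "d \<in> ?M"
        using quads_via_common[OF Z] .
      then have "a \<noteq> c" "a \<noteq> d" "a \<noteq> v" using a by (auto simp: nbs_def)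
      then show ?thesis using cd(1,2) by (auto simp: quad_def doubleton_eq_iff)
    qed
    then have "{Z \<in> ?P. {v, a} \<in> Z} = {}" by blast
    then show ?thesis by (simp only: card.empty)
  qed
  have "2 * card ?P = (\<Sum>a\<in>N v. card {Z \<in> ?P. {v, a} \<in> Z})"
    by (rule incidences_at[symmetric]) (use sub(1) in blast)
  also have "\<dots> = (\<Sum>a\<in>?M. card {Z \<in> ?P. {v, a} \<in> Z})"
  proof (rule sum.mono_neutral_right)
    show "\<forall>a \<in> N v - ?M. card {Z \<in> ?P. {v, a} \<in> Z} = 0" using out by blast
  qed (use finN in auto)
  finally have sum: "(\<Sum>a\<in>?M. card {Z \<in> ?P. {v, a} \<in> Z}) \<ge> 2 * card ?M"
    using big by (simp add: common_def)
  have full: "card {Z \<in> ?P. {v, a} \<in> Z} = 2" if a: "a \<in> ?M" for a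
  proof (rule ccontr)
    assume "card {Z \<in> ?P. {v, a} \<in> Z} \<noteq> 2"
    then have lt: "card {Z \<in> ?P. {v, a} \<in> Z} < 2" using le2[of a] a by fastforce
    have "(\<Sum>a\<in>?M. card {Z \<in> ?P. {v, a} \<in> Z}) < (\<Sum>a\<in>?M. 2)"
      by (rule sum_strict_mono_ex1) (use finN le2 lt a in auto)
    then show False using sum by simp
  qed
  have mirror: "{x, a} \<in> Z \<longleftrightarrow> {v, a} \<in> Z" if Z: "Z \<in> ?P" and a: "a \<in> ?M" for Z a
  proof -
    obtain c d where cd: "distinct [v, c, x, d]" "Z = quad v c x d" using quads_via_common[OF Z] by metis
    have "a \<noteq> v" "a \<noteq> x" using a by (auto simp: nbs_def)
    then show ?thesis using cd by (auto simp: quad_def doubleton_eq_iff)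
  qed
  obtain g Z where Z: "Z \<in> ?P" "g \<in> Z" and g: "card {Z \<in> ?P. g \<in> Z} = 1"
    using B_indepE[OF sub(2) \<open>?P \<noteq> {}\<close>] by blast
  obtain c d where cd: "distinct [v, c, x, d]" "Z = quad v c x d" "c \<in> ?M" "d \<in> ?M"
    using quads_via_common[OF Z(1)] .
  then have "\<exists>a \<in> ?M. g = {v, a} \<or> g = {x, a}" using Z(2) by (auto simp: quad_def insert_commute)
  then obtain a where a: "a \<in> ?M" "g = {v, a} \<or> g = {x, a}" by blast
  have "{Z \<in> ?P. g \<in> Z} = {Z \<in> ?P. {v, a} \<in> Z}" using a(2) mirror[OF _ a(1)] by blast
  then show False using full[OF a(1)] g by simp
qed

lemma quads_via_empty: "common v x \<le> 1 \<Longrightarrow> quads_via v x = {}"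
  using card_quads_via[of v x] finite_subset[of "quads_via v x" "cycles_at 4 v"] fin_cycles_at
  by (auto simp: quads_via_def)

lemma quad_at_via:
  assumes "Z \<in> cycles_at 4 v"
  obtains x where "x \<in> N2 v" "Z \<in> quads_via v x"
proof -
  obtain a x b where ab: "distinct [v, a, x, b]" "Z = quad v a x b" "a \<in> N v" "b \<in> N v" "a \<in> N x" "b \<in> N x"
    using quad_at[OF assms] .
  have "x \<in> N2 v" using ab by (auto simp: sq_def)
  moreover have "Z \<in> quads_via v x" using assms ab(1,2) by (auto simp: quads_via_def)
  ultimately show ?thesis by (rule that)
qed

text \<open>
  Without poles every 4-cycle at \<open>v\<close> has its opposite vertex at distance 2, so the
  short cycles of the basis are paid for by the defect.
\<close>

lemma count_le_defect:
  assumes "\<And>x. x \<in> N v \<Longrightarrow> common v x \<le> 1"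
  shows "2 * tri_count v + quad_count v \<le> defect v"
proof -
  let ?M = "N2 v - N v"
  have "cycles_at 4 v \<subseteq> (\<Union>x\<in>?M. quads_via v x)"
  proof
    fix Z assume "Z \<in> cycles_at 4 v"
    then obtain x where x: "x \<in> N2 v" "Z \<in> quads_via v x" by (rule quad_at_via)
    then have "x \<notin> N v" using quads_via_empty[OF assms, of x] by blast
    then show "Z \<in> (\<Union>x\<in>?M. quads_via v x)" using x by blast
  qed
  then have "quad_count v \<le> card (\<Union>x\<in>?M. quads_via v x)"
    by (rule card_mono[rotated]) (use finN2 fin_cycles_at in \<open>auto simp: quads_via_def\<close>)
  also have "\<dots> \<le> (\<Sum>x\<in>?M. card (quads_via v x))" using finN2 by (intro card_UN_le) auto
  also have "\<dots> \<le> (\<Sum>x\<in>?M. common v x - 1)" by (intro sum_mono card_quads_via)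
  finally show ?thesis using tri_count_le[of v] by (simp add: defect_def)
qed

text \<open>
  If \<open>u\<close> is a pole of a 4-cycle with a chord, then the only short cycles at
  \<open>u\<close> are the two triangles at the chord and the 4-cycle itself, and not all three
  belong to the independent family. Otherwise too many short cycles would make the defect at least 5
  and the number of square neighbors of \<open>u\<close> at most 11. Moreover a triangle and a
  4-cycle would share an edge \<open>ua\<close>, because an edge that is in no such pair carries at
  most one triangle or at most two 4-cycles. As there is no 5-cycle, \<open>a\<close> is then a
  pole, and \<open>ua\<close> is light.
\<close>

lemma charge_4_vertex:
  assumes d4: "deg u = 4"
  shows "2 * tri_count u + quad_count u \<le> 4"
proof (cases "\<exists>x \<in> N u. common u x \<ge> 2")
  case True
  then obtain x where x: "x \<in> N u" "common u x \<ge> 2" by blast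
  note p = pole_defect[OF x]
  let ?I = "{e \<in> E. e \<subseteq> N u}"
  obtain C where C: "C \<subseteq> N u \<inter> N x" "card C = 2"
    using x(2) obtain_subset_with_card_n[of 2 "N u \<inter> N x"] unfolding common_def by metis
  obtain a c where ac: "C = {a, c}" "a \<noteq> c" using C(2) by (auto simp: card_2_iff)
  have acN: "a \<in> N u" "c \<in> N u" "a \<in> N x" "c \<in> N x" using C(1) ac(1) by auto
  have I: "?I = {{x, a}, {x, c}}"
  proof (rule sym, rule card_subset_eq)
    show "finite ?I" using finE by simp
    show "{{x, a}, {x, c}} \<subseteq> ?I" using acN x(1) N_edge by auto
    show "card {{x, a}, {x, c}} = card ?I"
      using p(1) ac(2) by (simp add: inner_edges_def doubleton_eq_iff card_insert_if)
  qed
  have xa: "x \<noteq> a" "x \<noteq> c" "u \<noteq> x" "u \<noteq> a" "u \<noteq> c" using acN x(1) by (auto simp: nbs_def)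
  have T: "cycles_at 3 u \<subseteq> {tri u x a, tri u x c}"
  proof
    fix Z assume "Z \<in> cycles_at 3 u"
    then obtain s t where st: "Z = tri u s t" "s \<in> N u" "t \<in> N u" "t \<in> N s" by (elim tri_at)
    then have "{s, t} \<in> ?I" using N_edge by auto
    then have "{s, t} = {x, a} \<or> {s, t} = {x, c}" using I by simp
    then have "s = x \<and> t = a \<or> s = a \<and> t = x \<or> s = x \<and> t = c \<or> s = c \<and> t = x"
      by (auto simp: doubleton_eq_iff)
    then show "Z \<in> {tri u x a, tri u x c}"
      unfolding st(1) using tri_flip[of u a x] tri_flip[of u c x] by (elim disjE) simp_all
  qed
  have Q: "cycles_at 4 u \<subseteq> {quad u a x c}"
  proof
    fix Z assume "Z \<in> cycles_at 4 u"
    then obtain y where y: "y \<in> N2 u" "Z \<in> quads_via u y" by (rule quad_at_via)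
    have "y \<in> N u" using p(2)[of y] quads_via_empty[of u y] y by blast
    obtain s t where st: "distinct [u, s, y, t]" "Z = quad u s y t" "s \<in> N u \<inter> N y" "t \<in> N u \<inter> N y"
      using quads_via_common[OF y(2)] .
    have "{y, s} \<in> ?I" "{y, t} \<in> ?I" using st(3,4) \<open>y \<in> N u\<close> N_edge by auto
    then have "{y, s} \<in> {{x, a}, {x, c}}" "{y, t} \<in> {{x, a}, {x, c}}" using I by simp_all
    moreover have "s \<noteq> t" using st(1) by simp
    ultimately have "y = x \<and> (s = a \<and> t = c \<or> s = c \<and> t = a)"
      using xa ac(2) by (auto simp: doubleton_eq_iff)
    then show "Z \<in> {quad u a x c}"
      unfolding st(2) using quad_flip[of u c x a] by (elim conjE disjE) simp_all
  qed
  have t2: "tri_count u \<le> 2" using tri_count_le[of u] p(1) by simp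
  have q1: "quad_count u \<le> 1" using card_mono[OF _ Q] by simp
  show ?thesis
  proof (rule ccontr)
    assume "\<not> ?thesis"
    then have tq: "tri_count u = 2" "quad_count u = 1" using t2 q1 by auto
    have ne: "tri u x a \<noteq> tri u x c"
    proof -
      have "a \<in> \<Union>(tri u x a)" "a \<notin> \<Union>(tri u x c)" using xa ac(2) by (auto simp: Union_tri)
      then show ?thesis by metis
    qed
    have c3: "cycles_at 3 u = {tri u x a, tri u x c}"
      by (rule card_subset_eq) (use T tq ne in auto)
    have c4: "cycles_at 4 u = {quad u a x c}"
      by (rule card_subset_eq) (use Q tq in auto)
    have "tri u x a \<in> B" "tri u x c \<in> B" by (rule cycles_at_B[of _ 3 u], simp add: c3)+
    moreover have "quad u a x c \<in> B" by (rule cycles_at_B[of _ 4 u]) (simp add: c4)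
    ultimately have S: "{tri u x a, tri u x c, quad u a x c} \<subseteq> B" (is "?S \<subseteq> B") by simp
    obtain g Z0 where g: "card {Z \<in> ?S. g \<in> Z} = 1" by (rule B_indepE[OF S]) simp
    have "card (tri u x a) = 3" "card (tri u x c) = 3" "card (quad u a x c) = 4"
      using xa ac(2) by (auto intro!: card_tri card_quad)
    then have neq: "tri u x a \<noteq> quad u a x c" "tri u x c \<noteq> quad u a x c" by auto
    have "card {Z \<in> ?S. g \<in> Z} = of_bool (g \<in> tri u x a) + of_bool (g \<in> tri u x c) + of_bool (g \<in> quad u a x c)"
      by (rule card_filter_3[OF ne neq])
    moreover have "g \<in> quad u a x c \<longleftrightarrow> (g \<in> tri u x a) \<noteq> (g \<in> tri u x c)"
      by (rule quad_sum_tri) (use xa ac(2) in auto)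
    ultimately show False
      unfolding g by (cases "g \<in> tri u x a"; cases "g \<in> tri u x c") simp_all
  qed
next
  case False
  then have c1: "common u x \<le> 1" if "x \<in> N u" for x using that by fastforce
  show ?thesis
  proof (rule ccontr)
    assume n: "\<not> ?thesis"
    then have "defect u \<ge> 5" using count_le_defect[OF c1] by simp
    then have N2u: "card (N2 u) \<le> 11" using card_square_le[of u] d4 by simp
    have "\<exists>a \<in> N u. \<exists>T \<in> cycles_at 3 u. \<exists>Q \<in> cycles_at 4 u. {u, a} \<in> T \<and> {u, a} \<in> Q"
    proof (rule ccontr)
      assume no: "\<not> ?thesis"
      \<comment> \<open>summed over the four edges at \<open>u\<close>, this bounds twice the quantity in question by 8\<close>
      have le: "2 * card {Z \<in> cycles_at 3 u. {u, a} \<in> Z} + card {Z \<in> cycles_at 4 u. {u, a} \<in> Z} \<le> 2"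
        if a: "a \<in> N u" for a
      proof (cases "{Z \<in> cycles_at 3 u. {u, a} \<in> Z} = {}")
        case True
        have "card {Z \<in> cycles_at 4 u. {u, a} \<in> Z} \<le> 2"
          by (rule card_through_le_2) (use a in \<open>auto simp: cycles_at_def\<close>)
        then show ?thesis unfolding True by simp
      next
        case False
        then have Q: "{Z \<in> cycles_at 4 u. {u, a} \<in> Z} = {}" using no a by blast
        have form: "\<exists>b \<in> N u \<inter> N a. Z = tri u a b" if Z: "Z \<in> cycles_at 3 u" "{u, a} \<in> Z" for Z
        proof -
          obtain s t where st: "distinct [u, s, t]" "Z = tri u s t" "s \<in> N u" "t \<in> N u" "t \<in> N s"
            using tri_at[OF Z(1)] .
          have au: "a \<noteq> u" using a by (auto simp: nbs_def)
          then have "a = s \<or> a = t" using Z(2) st(1,2) by (auto simp: tri_def doubleton_eq_iff)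
          then show ?thesis
          proof
            assume "a = s"
            then show ?thesis using st by blast
          next
            assume "a = t"
            then have "s \<in> N a" using st(5) nbs_sym by fast
            moreover have "Z = tri u a s" using st(2) \<open>a = t\<close> tri_flip[of u s t] by simp
            ultimately show ?thesis using st(3) by blast
          qed
        qed
        have "{Z \<in> cycles_at 3 u. {u, a} \<in> Z} \<subseteq> tri u a ` (N u \<inter> N a)" using form by blast
        then have "card {Z \<in> cycles_at 3 u. {u, a} \<in> Z} \<le> card (tri u a ` (N u \<inter> N a))"
          using finN by (intro card_mono) auto
        also have "\<dots> \<le> common u a" unfolding common_def using finN by (intro card_image_le) auto
        finally show ?thesis unfolding Q using c1[OF a] by simp
      qed
      have "2 * (2 * tri_count u) + 2 * quad_count u =
          (\<Sum>a\<in>N u. 2 * card {Z \<in> cycles_at 3 u. {u, a} \<in> Z} + card {Z \<in> cycles_at 4 u. {u, a} \<in> Z})"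
        using incidences_at[of "cycles_at 3 u" u] incidences_at[of "cycles_at 4 u" u]
        by (simp add: sum.distrib flip: sum_distrib_left)
      also have "\<dots> \<le> (\<Sum>a\<in>N u. 2)" by (rule sum_mono) (rule le)
      finally show False using n d4 by simp
    qed
    then obtain a T Q where a: "a \<in> N u" and T: "T \<in> cycles_at 3 u" "{u, a} \<in> T"
      and Q: "Q \<in> cycles_at 4 u" "{u, a} \<in> Q" by blast
    have au: "a \<noteq> u" using a by (auto simp: nbs_def)
    have "\<exists>b. b \<noteq> a \<and> b \<in> N u \<and> b \<in> N a"
    proof -
      obtain s t where st: "distinct [u, s, t]" "T = tri u s t" "s \<in> N u" "t \<in> N u" "t \<in> N s"
        using tri_at[OF T(1)] .
      then have "a = s \<or> a = t" using T(2) au by (auto simp: tri_def doubleton_eq_iff)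
      moreover have "s \<in> N t" using st(5) nbs_sym by fast
      ultimately show ?thesis using st by auto
    qed
    then obtain b where b: "b \<noteq> a" "b \<in> N u" "b \<in> N a" by blast
    have "\<exists>y c. distinct [u, a, y, c] \<and> y \<in> N a \<and> c \<in> N y \<and> c \<in> N u"
    proof -
      obtain s y t where st: "distinct [u, s, y, t]" "Q = quad u s y t" "s \<in> N u" "t \<in> N u" "s \<in> N y" "t \<in> N y"
        using quad_at[OF Q(1)] .
      then have "a = s \<or> a = t" using Q(2) au by (auto simp: quad_def doubleton_eq_iff)
      then show ?thesis
      proof
        assume "a = s"
        then show ?thesis using st nbs_sym[of s E y] by (intro exI[of _ y] exI[of _ t]) auto
      next
        assume "a = t"
        then show ?thesis using st nbs_sym[of t E y] by (intro exI[of _ y] exI[of _ s]) auto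
      qed
    qed
    then obtain y c where yc: "distinct [u, a, y, c]" "y \<in> N a" "c \<in> N y" "c \<in> N u" by blast
    have bu: "b \<noteq> u" using b(2) by (auto simp: nbs_def)
    \<comment> \<open>\<open>u, b, a, y, c\<close> would be a 5-cycle unless \<open>b\<close> lies on the 4-cycle\<close>
    consider "b = y" | "b = c" | "b \<noteq> y" "b \<noteq> c" by blast
    then show False
    proof cases
      case 1
      then have "{a, c} \<subseteq> N u \<inter> N b" using a b yc nbs_sym[of b E a] by auto
      then have "card {a, c} \<le> common u b" unfolding common_def using finN by (intro card_mono) auto
      then show False using c1[OF b(2)] yc(1) by auto
    next
      case 2
      have "{u, y} \<subseteq> N a \<inter> N b" using a b yc 2 nbs_sym[of a E u] nbs_sym[of b E u] nbs_sym[of c E y] by auto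
      then have "card {u, y} \<le> common a b" unfolding common_def using finN by (intro card_mono) auto
      then have "common a b \<ge> 2" using yc(1) by auto
      then have "card (N2 a) \<le> 12" using pole_square_le[OF b(3)] by simp
      then show False using light_edge[OF a N2u] by simp
    next
      case 3
      have "{u, b} \<in> E" "{b, a} \<in> E" "{a, y} \<in> E" "{y, c} \<in> E" "{c, u} \<in> E"
        using b yc N_edge[of b u] N_edge[of b a] N_edge[of y a] N_edge[of c y] N_edge[of c u]
        by (auto simp: insert_commute)
      then show False using no5[of u b a y c] b(1) bu 3 yc(1) by auto
    qed
  qed
qed

section \<open>Discharging\<close>

definition V1 :: "'a set" where "V1 = {v \<in> V. N v \<noteq> {}}"

lemma fin_V1: "finite V1"
  using finV by (simp add: V1_def)

lemma N_V1: "w \<in> N v \<Longrightarrow> w \<in> V1"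
proof -
  assume w: "w \<in> N v"
  then have "v \<in> N w" using nbs_sym by fast
  then show "w \<in> V1" using w N_V by (auto simp: V1_def)
qed

lemma edge_V1: "e \<in> E \<Longrightarrow> e \<subseteq> V1"
proof
  fix v assume "e \<in> E" "v \<in> e"
  then obtain w where "w \<in> N v" by (rule edge_at)
  then have "v \<in> N w" using nbs_sym by fast
  then show "v \<in> V1" by (rule N_V1)
qed

lemma sum_deg: "(\<Sum>v\<in>V1. deg v) = 2 * card E"
proof -
  have "(\<Sum>v\<in>V1. deg v) = (\<Sum>v\<in>V1. card {e \<in> E. v \<in> e})" by (simp only: card_edges_at)
  also have "\<dots> = (\<Sum>e\<in>E. card {v \<in> V1. v \<in> e})" by (rule double_count[OF fin_V1 finE])
  also have "\<dots> = (\<Sum>e\<in>E. 2)"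
  proof (rule sum.cong[OF refl])
    fix e assume e: "e \<in> E"
    then obtain a b where ab: "a \<noteq> b" "e = {a, b}" by (elim edge_cases)
    have "{v \<in> V1. v \<in> e} = e" using edge_V1[OF e] by auto
    then show "card {v \<in> V1. v \<in> e} = 2" using ab by simp
  qed
  finally show ?thesis by simp
qed

lemma sum_cycles_at:
  assumes "\<And>Z. Z \<in> B \<Longrightarrow> card Z = k \<Longrightarrow> card (\<Union>Z) = k"
  shows "(\<Sum>v\<in>V1. card (cycles_at k v)) = k * card {Z \<in> B. card Z = k}"
proof -
  let ?Bk = "{Z \<in> B. card Z = k}"
  have "(\<Sum>v\<in>V1. card (cycles_at k v)) = (\<Sum>v\<in>V1. card {Z \<in> ?Bk. v \<in> \<Union>Z})"
  proof (rule sum.cong[OF refl])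
    fix v
    have "cycles_at k v = {Z \<in> ?Bk. v \<in> \<Union>Z}" unfolding cycles_at_def by blast
    then show "card (cycles_at k v) = card {Z \<in> ?Bk. v \<in> \<Union>Z}" by (rule arg_cong)
  qed
  also have "\<dots> = (\<Sum>Z\<in>?Bk. card {v \<in> V1. v \<in> \<Union>Z})"
    by (rule double_count) (use fin_V1 finB in auto)
  also have "\<dots> = (\<Sum>Z\<in>?Bk. k)"
  proof (rule sum.cong[OF refl])
    fix Z assume Z: "Z \<in> ?Bk"
    have "\<Union>Z \<subseteq> V1" using Z B_sub edge_V1 by blast
    then have "{v \<in> V1. v \<in> \<Union>Z} = \<Union>Z" by blast
    then have "card {v \<in> V1. v \<in> \<Union>Z} = card (\<Union>Z)" by (rule arg_cong)
    then show "card {v \<in> V1. v \<in> \<Union>Z} = k" using assms Z by simp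
  qed
  finally show ?thesis by simp
qed

lemma sum_tri_count: "(\<Sum>v\<in>V1. tri_count v) = 3 * card {Z \<in> B. card Z = 3}"
  by (rule sum_cycles_at) (erule B_triE, simp, simp add: Union_tri)

lemma sum_quad_count: "(\<Sum>v\<in>V1. quad_count v) = 4 * card {Z \<in> B. card Z = 4}"
  by (rule sum_cycles_at) (erule B_quadE, simp, simp add: Union_quad)

lemma sum_card_B: "(\<Sum>Z\<in>B. card Z) \<le> 2 * card E"
proof -
  have "(\<Sum>Z\<in>B. card Z) = (\<Sum>Z\<in>B. card {g \<in> E. g \<in> Z})"
  proof (rule sum.cong[OF refl])
    fix Z assume "Z \<in> B"
    then have "Z = {g \<in> E. g \<in> Z}" using B_sub by blast
    then show "card Z = card {g \<in> E. g \<in> Z}" by (rule arg_cong)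
  qed
  also have "\<dots> = (\<Sum>g\<in>E. card {Z \<in> B. g \<in> Z})" by (rule double_count[OF finB finE])
  also have "\<dots> \<le> (\<Sum>g\<in>E. 2)" by (rule sum_mono) (rule B_two)
  finally show ?thesis by simp
qed

text \<open>
  In Euler's formula a vertex contributes \<open>2 deg(v) - 6\<close>, a triangle \<open>-3\<close>
  and a 4-cycle \<open>-2\<close>. After doubling, each triangle charges 2 to each of its vertices,
  and each 4-cycle 1.
\<close>

definition charge :: "'a \<Rightarrow> int" where
  "charge v = 4 * int (deg v) - 12 - 2 * int (tri_count v) - int (quad_count v)"

lemma total_charge_negative: "(\<Sum>v\<in>V1. charge v) < 0"
proof -
  let ?B3 = "card {Z \<in> B. card Z = 3}" and ?B4 = "card {Z \<in> B. card Z = 4}"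
  have "6 * card B = (\<Sum>Z\<in>B. 6)" by simp
  also have "\<dots> \<le> (\<Sum>Z\<in>B. card Z + 3 * of_bool (card Z = 3) + 2 * of_bool (card Z = 4))"
    by (rule sum_mono) (use card_B_cases in fastforce)
  also have "\<dots> = (\<Sum>Z\<in>B. card Z) + 3 * (\<Sum>Z\<in>B. of_bool (card Z = 3)) + 2 * (\<Sum>Z\<in>B. of_bool (card Z = 4))"
    by (simp only: sum.distrib sum_distrib_left)
  also have "(\<Sum>Z\<in>B. of_bool (card Z = 3)) = ?B3"
    using finB by (simp add: Int_def)
  also have "(\<Sum>Z\<in>B. of_bool (card Z = 4)) = ?B4"
    using finB by (simp add: Int_def)
  finally have "6 * card B \<le> 2 * card E + 3 * ?B3 + 2 * ?B4" using sum_card_B by linarith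
  moreover have "card E + 1 \<le> card B + card V1" using B_euler by (simp add: V1_def)
  moreover have "(\<Sum>v\<in>V1. charge v) =
      4 * int (\<Sum>v\<in>V1. deg v) - 12 * int (card V1) - 2 * int (\<Sum>v\<in>V1. tri_count v) - int (\<Sum>v\<in>V1. quad_count v)"
    by (simp add: charge_def sum_subtractf flip: sum_distrib_left)
  ultimately show ?thesis unfolding sum_deg sum_tri_count sum_quad_count by linarith
qed

text \<open>
  The vertices that need help: a vertex of degree at most 3 that is not poor has degree 3 and charge
  0.
\<close>

definition poor :: "'a \<Rightarrow> bool" where
  "poor v \<longleftrightarrow> deg v \<le> 3 \<and> card (N2 v) \<le> 11"

definition demand :: "'a \<Rightarrow> int" where
  "demand v = (if poor v then 5 - int (deg v) else 0)"

text \<open>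
  Two adjacent vertices of degree at most 3 form a light edge: each has at most
  \<open>3 + 4 + 4\<close> neighbors in the square.
\<close>

lemma low_neighbors:
  assumes "deg v \<le> 3" "w \<in> N v"
  shows "deg w = 4"
proof (rule ccontr)
  assume "deg w \<noteq> 4"
  then have w: "deg w \<le> 3" using deg4[of w] by linarith
  have bound: "card (N2 x) \<le> 11" if x: "deg x \<le> 3" "y \<in> N x" "deg y \<le> 3" for x y
  proof -
    have "(\<Sum>a\<in>N x. deg a) = deg y + (\<Sum>a\<in>N x - {y}. deg a)"
      by (rule sum.remove[OF finN x(2)])
    also have "(\<Sum>a\<in>N x - {y}. deg a) \<le> (\<Sum>a\<in>N x - {y}. 4)" by (rule sum_mono) (rule deg4)
    also have "\<dots> = 4 * (deg x - 1)" using x(2) by (simp add: finN)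
    finally show ?thesis using card_square_nbs[of x] x by linarith
  qed
  have "v \<in> N w" using assms(2) nbs_sym by fast
  then have "card (N2 v) \<le> 11" "card (N2 w) \<le> 11" using bound assms w by blast+
  then show False using light_edge[OF assms(2)] by simp
qed

lemma poor_of_deg_le_2: "deg v \<le> 2 \<Longrightarrow> poor v"
  using card_square_le[of v] by (simp add: poor_def)

lemma no_leaf:
  assumes "v \<in> V1" shows "deg v \<ge> 2"
proof (rule ccontr)
  assume "\<not> deg v \<ge> 2"
  then have d: "deg v \<le> 1" by simp
  have "N v \<noteq> {}" using assms by (simp add: V1_def)
  then show False
  proof (rule reducible_simplicial)
    show "{a, b} \<in> E" if "a \<in> N v" "b \<in> N v" "a \<noteq> b" for a b
    proof -
      have "card {a, b} \<le> deg v" using that finN by (intro card_mono) auto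
      then show ?thesis using that(3) d by simp
    qed
    show "card (N2 v) \<le> 11" using card_square_le[of v] d by simp
  qed
qed

lemma deg_2_no_triangle:
  assumes "deg v = 2" shows "tri_count v = 0"
proof (rule ccontr)
  assume "tri_count v \<noteq> 0"
  then have "cycles_at 3 v \<noteq> {}" by auto
  then obtain Z where "Z \<in> cycles_at 3 v" by blast
  then obtain a b where ab: "distinct [v, a, b]" "a \<in> N v" "b \<in> N v" "b \<in> N a" by (elim tri_at)
  have Nv: "N v = {a, b}"
    by (rule sym, rule card_subset_eq[OF finN]) (use ab assms in auto)
  have "{a, b} \<in> E" "{b, a} \<in> E" using N_edge[OF ab(4)] by (simp_all add: insert_commute)
  then show False
    by (intro reducible_simplicial[of v]) (use Nv card_square_le[of v] assms in auto)
qed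

lemma rich_charge:
  assumes "deg v = 3" "\<not> poor v" shows "charge v = 0"
proof -
  have "defect v = 0" using card_square_le[of v] assms by (simp add: poor_def)
  then have i: "inner_edges v = 0" by (simp add: defect_def)
  have "common v x \<le> 1" if "x \<in> N v" for x
    using two_common_inner_edges[OF that] i by linarith
  then have "2 * tri_count v + quad_count v \<le> 0" using count_le_defect[of v] \<open>defect v = 0\<close> by simp
  then show ?thesis using assms(1) by (simp add: charge_def)
qed

text \<open>
  Let \<open>L\<close> be the set of neighbors of \<open>u\<close> of degree at most 3. Recoloring
  \<open>u\<close>, then the members of \<open>L\<close> that are not poor, and finally the poor
  ones, is possible if \<open>u\<close> has at most \<open>11 + |L|\<close> neighbors in the square,
  because a member that is not poor still has \<open>v\<close> uncolored nearby. So there are at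
  least \<open>12 + |L|\<close> of them. Since every \<open>x\<close> in \<open>L\<close> lowers the
  bound 16 by \<open>4 - deg(x)\<close>, this limits the defect.
\<close>

lemma charge_near_poor:
  assumes d4: "deg u = 4" and v: "v \<in> N u" "poor v"
  shows "(\<Sum>x \<in> {x \<in> N u. deg x \<le> 3}. 5 - deg x) + 2 * tri_count u + quad_count u \<le> 4"
proof -
  let ?L = "{x \<in> N u. deg x \<le> 3}"
  let ?X = "{x \<in> ?L. \<not> poor x}" and ?Y = "{x \<in> ?L. poor x}"
  have XY: "?X \<union> ?Y = ?L" by blast
  have vY: "v \<in> ?Y" using v by (simp add: poor_def)
  have LN: "?L \<subseteq> N2 u" by (auto simp: sq_def nbs_def)
  have finL: "finite ?L" using finN by simp
  have "12 + card ?L \<le> card (N2 u)"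
  proof (rule ccontr)
    assume n: "\<not> ?thesis"
    have uv: "{u, v} \<in> E" using N_edge v(1) by blast
    show False
    proof (rule reducible_stages[of "{u, v}" u ?X ?Y])
      show "{u, v} \<subseteq> insert u (?X \<union> ?Y)" using vY by blast
      have "u \<in> N v" using v(1) nbs_sym by fast
      then show "insert u (?X \<union> ?Y) \<subseteq> V" unfolding XY using N_V by blast
      show "u \<notin> ?X \<union> ?Y" unfolding XY by (simp add: nbs_def)
      show "card (N2 u - (?X \<union> ?Y)) \<le> 11"
        unfolding XY using n card_Diff_subset[OF finL LN] by linarith
      show "card (N2 x - ?Y) \<le> 11" if x: "x \<in> ?X" for x
      proof -
        have "v \<noteq> x" using x v(2) by auto
        moreover have "u \<in> N v" "u \<in> N x" using x v(1) nbs_sym by (fast, fast)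
        ultimately have vx: "v \<in> N2 x" by (auto simp: sq_def)
        have "card (N2 x - ?Y) \<le> card (N2 x - {v})" using vY finN2 by (intro card_mono) auto
        also have "\<dots> = card (N2 x) - 1" using vx finN2 by simp
        also have "\<dots> \<le> 11"
        proof -
          have "deg x \<le> 3" using x by simp
          then show ?thesis using card_square_le[of x] by linarith
        qed
        finally show ?thesis .
      qed
    qed (use uv in \<open>auto simp: poor_def\<close>)
  qed
  moreover have "(\<Sum>x\<in>N u. deg x) + (\<Sum>x\<in>?L. 4 - deg x) \<le> 16"
  proof -
    have "(\<Sum>x\<in>?L. 4 - deg x) \<le> (\<Sum>x\<in>N u. 4 - deg x)" using finN by (intro sum_mono2) auto
    then have "(\<Sum>x\<in>N u. deg x) + (\<Sum>x\<in>?L. 4 - deg x) \<le> (\<Sum>x\<in>N u. deg x + (4 - deg x))"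
      by (simp add: sum.distrib)
    also have "\<dots> = (\<Sum>x\<in>N u. 4)" using deg4 by (intro sum.cong) auto
    finally show ?thesis using d4 by simp
  qed
  moreover have "(\<Sum>x\<in>?L. 5 - deg x) = card ?L + (\<Sum>x\<in>?L. 4 - deg x)"
  proof -
    have "(\<Sum>x\<in>?L. 5 - deg x) = (\<Sum>x\<in>?L. 1 + (4 - deg x))" by (intro sum.cong) auto
    then show ?thesis by (simp only: sum.distrib card_eq_sum)
  qed
  ultimately have main: "defect u + (\<Sum>x\<in>?L. 5 - deg x) \<le> 4" using card_square_nbs[of u] by linarith
  have "(\<Sum>x\<in>{v}. 5 - deg x) \<le> (\<Sum>x\<in>?L. 5 - deg x)" using finL vY by (intro sum_mono2) auto
  then have "5 - deg v \<le> (\<Sum>x\<in>?L. 5 - deg x)" by simp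
  moreover have "2 \<le> 5 - deg v" using v(2) unfolding poor_def by linarith
  ultimately have "defect u \<le> 2" using main by linarith
  then have "inner_edges u \<le> 1" by (simp add: defect_def)
  then have "common u x \<le> 1" if "x \<in> N u" for x using two_common_inner_edges[OF that] by linarith
  then show ?thesis using count_le_defect[of u] main by simp
qed

text \<open>
  Every poor vertex receives its demand from each of its neighbors, which have degree 4. This makes
  up for a charge of at least \<open>-6\<close> at degree 2 or 3; a vertex of degree 3 that is not
  poor has charge 0.
\<close>

lemma final_charge:
  assumes v: "v \<in> V1"
  shows "charge v + int (deg v) * demand v - (\<Sum>w\<in>N v. demand w) \<ge> 0"
proof -
  have nbr0: "(\<Sum>w\<in>N v. demand w) = 0" if "deg v \<le> 3"
    using low_neighbors[OF that] by (intro sum.neutral) (simp add: demand_def poor_def)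
  consider "deg v = 2" | "deg v = 3" | "deg v = 4" using no_leaf[OF v] deg4[of v] by linarith
  then show ?thesis
  proof cases
    case 1
    then have "demand v = 3" using poor_of_deg_le_2[of v] by (simp add: demand_def)
    then show ?thesis
      using 1 nbr0 deg_2_no_triangle[OF 1] tri_quad_count_le_deg[of v] by (simp add: charge_def)
  next
    case 2
    show ?thesis
    proof (cases "poor v")
      case True
      then show ?thesis using 2 nbr0 tri_quad_count_le_deg[of v] by (simp add: charge_def demand_def)
    next
      case False
      then show ?thesis using rich_charge[OF 2 False] 2 nbr0 by (simp add: demand_def)
    qed
  next
    case 3
    then have d0: "demand v = 0" by (simp add: demand_def poor_def)
    show ?thesis
    proof (cases "\<exists>w \<in> N v. poor w")
      case True
      then obtain w where w: "w \<in> N v" "poor w" by blast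
      let ?L = "{x \<in> N v. deg x \<le> 3}"
      have "(\<Sum>w\<in>N v. demand w) = (\<Sum>w\<in>?L. demand w)"
        by (rule sum.mono_neutral_right) (use finN in \<open>auto simp: demand_def poor_def\<close>)
      also have "\<dots> \<le> (\<Sum>w\<in>?L. int (5 - deg w))"
        by (rule sum_mono) (auto simp: demand_def)
      also have "\<dots> = int (\<Sum>w\<in>?L. 5 - deg w)" by simp
      finally have "(\<Sum>w\<in>N v. demand w) + 2 * int (tri_count v) + int (quad_count v) \<le> 4"
        using charge_near_poor[OF 3 w] by linarith
      then show ?thesis using 3 d0 by (simp add: charge_def)
    next
      case False
      then have "(\<Sum>w\<in>N v. demand w) = 0" by (intro sum.neutral) (simp add: demand_def)
      then show ?thesis using charge_4_vertex[OF 3] 3 d0 by (simp add: charge_def)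
    qed
  qed
qed

theorem no_critical_basis: False
proof -
  have "(\<Sum>v\<in>V1. \<Sum>w\<in>N v. demand w) = (\<Sum>v\<in>V1. \<Sum>w | w \<in> V1 \<and> w \<in> N v. demand w)"
    using N_V1 by (intro sum.cong) auto
  also have "\<dots> = (\<Sum>w\<in>V1. \<Sum>v | v \<in> V1 \<and> w \<in> N v. demand w)"
    by (rule sum.swap_restrict[OF fin_V1 fin_V1])
  also have "\<dots> = (\<Sum>w\<in>V1. int (deg w) * demand w)"
  proof (rule sum.cong[OF refl])
    fix w
    have "{v. v \<in> V1 \<and> w \<in> N v} = N w" using N_V1 nbs_sym[of w E] by blast
    then show "(\<Sum>v | v \<in> V1 \<and> w \<in> N v. demand w) = int (deg w) * demand w" by simp
  qed
  finally have "(\<Sum>v\<in>V1. charge v + int (deg v) * demand v - (\<Sum>w\<in>N v. demand w)) = (\<Sum>v\<in>V1. charge v)"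
    by (simp add: sum.distrib sum_subtractf)
  moreover have "(\<Sum>v\<in>V1. charge v + int (deg v) * demand v - (\<Sum>w\<in>N v. demand w)) \<ge> 0"
    by (rule sum_nonneg) (rule final_charge)
  ultimately show False using total_charge_negative by simp
qed

end

section \<open>Squares of planar graphs without 5-cycles\<close>

lemma uedges_iff:
  assumes "pair_graph G"
  shows "{u, v} \<in> uedges G \<longleftrightarrow> (u, v) \<in> parcs G"
proof -
  interpret pair_graph G by fact
  have sym: "(b, a) \<in> parcs G" if "(a, b) \<in> parcs G" for a b using that by (rule arcs_symmetric)
  show ?thesis unfolding uedges_def using sym by (auto simp: doubleton_eq_iff)
qed

lemma uedges_ends:
  assumes "pair_graph G" "e \<in> uedges G"
  shows "\<exists>u v. u \<in> pverts G \<and> v \<in> pverts G \<and> u \<noteq> v \<and> e = {u, v}"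
proof -
  interpret pair_graph G by fact
  obtain u v where "e = {u, v}" "(u, v) \<in> parcs G" using assms(2) by (auto simp: uedges_def)
  then show ?thesis using in_arcsD1 in_arcsD2 no_loops' by blast
qed

lemma card_nbs_le_max_degree:
  assumes G: "pair_graph G"
  shows "card (nbs (uedges G) v) \<le> max_degree G"
proof -
  interpret pair_graph G by fact
  let ?D = "out_degree (with_proj G)"
  have sub: "(\<lambda>w. (v, w)) ` nbs (uedges G) v \<subseteq> out_arcs (with_proj G) v"
    using uedges_iff[OF G] by (auto simp: nbs_def out_arcs_def)
  have fin: "finite (out_arcs (with_proj G) v)"
    using finite_subset[OF _ finite_arcs] by (auto simp: out_arcs_def)
  have "card (nbs (uedges G) v) = card ((\<lambda>w. (v, w)) ` nbs (uedges G) v)"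
    by (rule card_image[symmetric]) (simp add: inj_on_def)
  also have "\<dots> \<le> ?D v" unfolding out_degree_def by (rule card_mono[OF fin sub])
  finally have le: "card (nbs (uedges G) v) \<le> ?D v" .
  show ?thesis
  proof (cases "v \<in> pverts G")
    case True
    then have "?D v \<le> max_degree G" unfolding max_degree_def by (intro Max_ge) auto
    then show ?thesis using le by simp
  next
    case False
    then have "nbs (uedges G) v = {}" using uedges_iff[OF G] in_arcsD1 by (auto simp: nbs_def)
    then show ?thesis by simp
  qed
qed

lemma graph_dist_le_2_imp_sq:
  assumes G: "pair_graph G" and uv: "u \<noteq> v" and d: "graph_dist G u v \<le> 2"
  shows "v \<in> sq (uedges G) u"
proof -
  interpret pair_graph G by fact
  have "(INF p\<in>{p. awalk u p v}. ereal (awalk_cost (\<lambda>_. 1) p)) < 3"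
    using d unfolding graph_dist_def \<mu>_def by (rule le_less_trans) simp
  then obtain p where p: "awalk u p v" "ereal (awalk_cost (\<lambda>_. 1) p) < 3"
    by (auto simp: INF_less_iff)
  have "awalk_cost (\<lambda>_. 1) p = real (length p)"
    by (simp add: awalk_cost_def sum_list_triv)
  then have "real (length p) < 3" using p(2) by simp
  then have len: "length p < 3" by simp
  have p': "set p \<subseteq> parcs G" "pcas u p v" using p(1) by (auto simp: awalk_def)
  have ne: "a \<noteq> b" if "(a, b) \<in> parcs G" for a b using that no_loops' by blast
  have nb: "b \<in> nbs (uedges G) a \<and> a \<in> nbs (uedges G) b" if "(a, b) \<in> parcs G" for a b
    using that ne[OF that] uedges_iff[OF G, of a b] by (auto simp: nbs_def insert_commute)
  consider "p = []" | a where "p = [a]" | a b where "p = [a, b]"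
    using len by (cases p; cases "tl p"; cases "tl (tl p)") auto
  then show ?thesis
  proof cases
    case 1
    then show ?thesis using p'(2) uv by simp
  next
    case 2
    then have "(u, v) \<in> parcs G" using p' by (cases a) auto
    then show ?thesis using nb uv by (auto simp: sq_def)
  next
    case 3
    then obtain w where "(u, w) \<in> parcs G" "(w, v) \<in> parcs G" using p' by (cases a; cases b) auto
    then have "w \<in> nbs (uedges G) u \<inter> nbs (uedges G) v" using nb by blast
    then show ?thesis using uv by (auto simp: sq_def)
  qed
qed

lemma five_cycle:
  assumes G: "pair_graph G" and d: "distinct [a, b, c, d, e]"
    and "{a, b} \<in> uedges G" "{b, c} \<in> uedges G" "{c, d} \<in> uedges G" "{d, e} \<in> uedges G" "{e, a} \<in> uedges G"
  shows "has_cycle_of_length G 5"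
proof -
  interpret pair_graph G by fact
  let ?p = "[(a, b), (b, c), (c, d), (d, e), (e, a)]"
  have arcs: "set ?p \<subseteq> parcs G" using assms uedges_iff[OF G] by simp
  then have "a \<in> pverts G" using in_arcsD1[of a b] by auto
  then have "pre_digraph.cycle (with_proj G) ?p"
    unfolding pre_digraph.cycle_def pre_digraph.awalk_def using arcs d
    by (intro exI[of _ a]) (auto simp: pre_digraph.cas.simps pre_digraph.awalk_verts.simps)
  then show ?thesis unfolding has_cycle_of_length_def by (intro exI[of _ ?p]) simp
qed

lemma list_coloring_of_square_colorable:
  assumes G: "pair_graph G" and c: "square_colorable (uedges G) L (pverts G)"
  shows "\<exists>c. list_coloring (graph_square G) L c"
proof -
  obtain c where c: "\<forall>v \<in> pverts G. c v \<in> L v"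
    "\<forall>v \<in> pverts G. \<forall>w \<in> pverts G. w \<in> sq (uedges G) v \<longrightarrow> c v \<noteq> c w"
    using assms(2) unfolding square_colorable_def by blast
  have "proper_coloring (graph_square G) c"
    unfolding proper_coloring_def graph_square_def
    using c(2) graph_dist_le_2_imp_sq[OF G] by auto
  then show ?thesis using c(1) by (auto simp: list_coloring_def graph_square_def)
qed

text \<open>
  The isolated vertices of the minimal counterexample are dropped from its drawing, so that the
  count of vertices in the basis theorem matches the one in the discharging argument.
\<close>

lemma planar_square_colorable:
  assumes G: "pair_graph G" and planar: "planar G" and no5: "\<not> has_cycle_of_length G 5"
    and deg: "max_degree G \<le> 4"
    and L: "\<And>v. v \<in> pverts G \<Longrightarrow> finite (L v) \<and> card (L v) = 12"
  shows "square_colorable (uedges G) L (pverts G)"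
proof (rule ccontr)
  interpret pair_graph G by fact
  let ?V = "pverts G"
  assume "\<not> ?thesis"
  then have "\<exists>E. E \<subseteq> uedges G \<and> \<not> square_colorable E L ?V" by blast
  then obtain E where E: "E \<subseteq> uedges G" "\<not> square_colorable E L ?V"
    and least: "\<And>E'. E' \<subseteq> uedges G \<and> \<not> square_colorable E' L ?V \<Longrightarrow> card E \<le> card E'"
    using ex_has_least_nat[of "\<lambda>E. E \<subseteq> uedges G \<and> \<not> square_colorable E L ?V" _ card] by metis
  have fin_u: "finite (uedges G)"
  proof (rule finite_subset)
    show "uedges G \<subseteq> Pow ?V" using uedges_ends[OF G] by blast
  qed simp
  have finE: "finite E" using finite_subset[OF E(1) fin_u] .
  interpret edge_critical ?V E L
  proof
    show "finite ?V" by simp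
    show "\<exists>u v. u \<in> ?V \<and> v \<in> ?V \<and> u \<noteq> v \<and> e = {u, v}" if "e \<in> E" for e
      using uedges_ends[OF G] E(1) that by blast
    show "card (nbs E v) \<le> 4" for v
    proof -
      have "nbs E v \<subseteq> nbs (uedges G) v" using E(1) by (auto simp: nbs_def)
      moreover have "finite (nbs (uedges G) v)"
      proof (rule finite_subset)
        show "nbs (uedges G) v \<subseteq> ?V"
          using uedges_iff[OF G] in_arcsD2 by (auto simp: nbs_def)
      qed simp
      ultimately have "card (nbs E v) \<le> card (nbs (uedges G) v)" by (intro card_mono)
      then show ?thesis using card_nbs_le_max_degree[OF G, of v] deg by linarith
    qed
    show "\<not> ({a, b} \<in> E \<and> {b, c} \<in> E \<and> {c, d} \<in> E \<and> {d, e} \<in> E \<and> {e, a} \<in> E)"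
      if "distinct [a, b, c, d, e]" for a b c d e
      using five_cycle[OF G that] no5 E(1) by blast
    show "finite (L v) \<and> card (L v) = 12" if "v \<in> ?V" for v using L that .
    show "\<not> square_colorable E L ?V" by fact
    show "square_colorable (E - D) L ?V" if D: "D \<subseteq> E" "D \<noteq> {}" for D
    proof (rule ccontr)
      assume "\<not> square_colorable (E - D) L ?V"
      then have "card E \<le> card (E - D)" using least[of "E - D"] E(1) by blast
      moreover have "card (E - D) < card E" using D finE by (intro psubset_card_mono) auto
      ultimately show False by simp
    qed
  qed
  have "E \<noteq> {}"
  proof
    assume "E = {}"
    then have "sq E v = {}" for v by (simp add: sq_def nbs_def)
    moreover have "\<forall>v \<in> ?V. \<exists>k. k \<in> L v" using L by (metis card.empty equals0I zero_neq_numeral)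
    then obtain c where "\<forall>v \<in> ?V. c v \<in> L v" by metis
    ultimately have "square_colorable E L ?V" by (auto simp: square_colorable_def)
    then show False using E(2) by simp
  qed
  let ?V1 = "{v \<in> ?V. nbs E v \<noteq> {}}"
  have ends: "\<exists>u v. u \<in> ?V1 \<and> v \<in> ?V1 \<and> u \<noteq> v \<and> e = {u, v}" if e: "e \<in> E" for e
  proof -
    obtain u v where uv: "u \<in> ?V" "v \<in> ?V" "u \<noteq> v" "e = {u, v}" using edges[OF e] by blast
    then have "v \<in> nbs E u" "u \<in> nbs E v" using e by (auto simp: nbs_def insert_commute)
    then show ?thesis using uv by blast
  qed
  obtain p \<gamma> where pl: "plane_drawing G p \<gamma>" using planar by (auto simp: planar_def)
  have arcs: "Path_Connected.arc (\<gamma> e) \<and> {pathstart (\<gamma> e), pathfinish (\<gamma> e)} = p ` e \<and>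
      path_image (\<gamma> e) \<inter> p ` ?V = p ` e" if "e \<in> E" for e
    using pl subsetD[OF E(1) that] unfolding plane_drawing_def by blast
  interpret dr: drawing ?V1 p \<gamma> E
  proof
    show "finite ?V1" by simp
    show "finite E" by fact
    show "\<exists>u v. u \<in> ?V1 \<and> v \<in> ?V1 \<and> u \<noteq> v \<and> e = {u, v}" if "e \<in> E" for e by (rule ends[OF that])
    show "inj_on p ?V1" using pl by (auto simp: plane_drawing_def intro: inj_on_subset)
    show "Path_Connected.arc (\<gamma> e)" "{pathstart (\<gamma> e), pathfinish (\<gamma> e)} = p ` e" if "e \<in> E" for e
      using arcs[OF that] by auto
    show "path_image (\<gamma> e) \<inter> p ` ?V1 = p ` e" if e: "e \<in> E" for e
    proof -
      have "path_image (\<gamma> e) \<inter> p ` ?V = p ` e" using arcs[OF e] by simp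
      moreover have "e \<subseteq> ?V1" using ends[OF e] by blast
      ultimately show ?thesis by blast
    qed
    show "path_image (\<gamma> e) \<inter> path_image (\<gamma> e') \<subseteq> p ` (e \<inter> e')"
      if "e \<in> E" "e' \<in> E" "e \<noteq> e'" for e e'
    proof -
      have "e \<in> uedges G" "e' \<in> uedges G" using that E(1) by auto
      then show ?thesis using pl that(3) unfolding plane_drawing_def by blast
    qed
  qed
  have "?V1 \<noteq> {}" using ends \<open>E \<noteq> {}\<close> by blast
  from dr.planar_two_basis[OF this]
  obtain B where B: "finite B" "\<forall>Z \<in> B. Z \<subseteq> E \<and> even_edges Z"
    "\<forall>g \<in> E. card {Z \<in> B. g \<in> Z} \<le> 2"
    "\<forall>S \<subseteq> B. S \<noteq> {} \<longrightarrow> (\<exists>g. card {Z \<in> S. g \<in> Z} = 1)"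
    "card E + 1 \<le> card B + card ?V1"
    by (elim exE conjE) (rule that; assumption)
  interpret critical_basis ?V E L B
  proof
    show "finite B" by (rule B(1))
    show "Z \<subseteq> E" "even_edges Z" if "Z \<in> B" for Z using B(2) that by simp_all
    show "card {Z \<in> B. g \<in> Z} \<le> 2" if "g \<in> E" for g using B(3) that by simp
    show "\<exists>g. card {Z \<in> S. g \<in> Z} = 1" if "S \<subseteq> B" "S \<noteq> {}" for S
      by (rule B(4)[rule_format, OF that])
    show "card E + 1 \<le> card B + card ?V1" by (rule B(5))
  qed
  show False by (rule no_critical_basis)
qed

theorem theorem2:
  fixes G :: "'a pair_pre_digraph"
  assumes "pair_graph G"
    and "planar G"
    and "\<not> has_cycle_of_length G 5"
    and "max_degree G \<le> 4"
  shows "choosability (graph_square G) \<le> 12"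
proof -
  have "choosable (graph_square G) 12"
    unfolding choosable_def
  proof (intro allI impI)
    fix L :: "'a \<Rightarrow> nat set"
    assume "\<forall>v \<in> pverts (graph_square G). finite (L v) \<and> card (L v) = 12"
    then have "\<And>v. v \<in> pverts G \<Longrightarrow> finite (L v) \<and> card (L v) = 12" by (simp add: graph_square_def)
    then have "square_colorable (uedges G) L (pverts G)"
      by (rule planar_square_colorable[OF assms])
    then show "\<exists>c. list_coloring (graph_square G) L c"
      by (rule list_coloring_of_square_colorable[OF assms(1)])
  qed
  then show ?thesis unfolding choosability_def by (rule Least_le)
qed

end
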